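(* For a $\mathbb{Z}$-labelled graph $(\hat G,z)$, the following are equivalent: (i) $\mathrm{rd}(\hat G,z)\le1$; (ii) $(\hat G,z)$ has no minor isomorphic to $(K_3,0)$ nor to $(K_2^\bullet,w)$ for any simple labelling $w$; (iii) $(\hat G,z)$ is obtained by a sequence of disjoint unions and $1$-sums of $\mathbb{Z}$-labelled graphs in $\mathcal F$, where $\mathcal F$ consists of all $\mathbb{Z}$-labelled graphs isomorphic either to $(K_2,0)$ or to a $\mathbb{Z}$-labelled graph with a single vertex; (iv) $\hat G$ does not contain a cycle other than selfloops.
   Context: A $\mathbb{Z}$-labelled graph $(\hat G,z)$ is a finite directed multigraph $\hat G=(\hat V,\hat E)$ (selfloops allowed) with a simple labelling $z:\hat E\to\mathbb{Z}$ (selfloops have nonzero labels; no two parallel edges with the same direction and label, nor opposite directions and opposite labels); an edge from $i$ to $j$ with label $\gamma$ is $(i,j;\gamma)$. A cycle is a closed walk $v_1e_1v_2\cdots e_kv_1$ (each $e_t$ an edge with endvertices $v_t,v_{t+1}$, directions ignored) with $v_1,\dots,v_k$ distinct; in particular two parallel edges form a cycle. Minor operations: edge inversion (reverse an edge, negate its label); switching at vertex $i$ by $\gamma$ (each non-loop edge $(i,j;\alpha)$ becomes $(i,j;\alpha+\gamma)$, each non-loop edge $(j,i;\alpha)$ becomes $(j,i;\alpha-\gamma)$). Two $\mathbb{Z}$-labelled graphs are isomorphic if after edge inversions and switchings there is a vertex bijection mapping labelled directed edges exactly onto labelled directed edges. Deletion removes an edge or a vertex (with incident edges), restricting labels. Contraction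 of a non-loop edge $e=(i,j;0)$ identifies $i,j$, removes $e$, and deletes selfloops of label $0$ and redundant parallel edges so the labelling stays simple. A minor is (up to isomorphism) the result of a sequence of deletions and contractions; a subgraph uses only deletions. Union and sums: if $(\hat G_1,z_1)$, $(\hat G_2,z_2)$ are subgraphs of $(\hat G,z)$ (with restricted labels) with $\hat V_1\cup\hat V_2=\hat V$ and $\hat E_1\cup\hat E_2=\hat E$, then $(\hat G,z)$ is their union; it is their disjoint union if $\hat V_1\cap\hat V_2=\emptyset$, and a $1$-sum if $\hat V_1\cap\hat V_2$ is a single vertex. $(K_k,0)$ is the simple complete graph on $k$ vertices (edges oriented arbitrarily) with all labels $0$. $K_2^\bullet$ is the directed multigraph on $\{1,2\}$ with two parallel edges from $1$ to $2$. The lift graph of $(\hat G,z)$ has vertex set $\hat V\times\mathbb{Z}$ (elements $i+\gamma$), edges $\{i+\gamma,j+\gamma+z(e)\}$ for edges $e=(i,j;z(e))$, $\gamma\in\mathbb{Z}$, with $\mathbb{Z}$ acting by translation. For nonzero $\ell\in\mathbb{R}^d$, an $\ell$-periodic framework in $\mathbb{R}^d$ is a map $p$ from the lift graph's vertices to $\mathbb{R}^d$ with $p(v+1)-p(v)=\ell$; periodic frameworks (possibly in different dimensions) are equivalent if all edge lengths agree and their lattice vectors have equal length. $(\hat G,z)$ is $d$-realizable if every periodic framework of its lift graph in any dimension admits an equivalent periodic framework in $\mathbb{R}^d$; $\mathrm{rd}(\hat G,z)$ is the least such nonnegative integer $d$. *)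

theory Defs
  imports
    "HOL-Analysis.Analysis"
    "HOL-Library.Extended_Nat"
    "Graph_Theory.Digraph"
    "Graph_Theory.Digraph_Component"
begin

subsection \<open>Integer-labelled graphs\<close>

type_synonym ('v, 'e) zgraph = "('v, 'e) pre_digraph \<times> ('e \<Rightarrow> int)"

text \<open>
  Two arcs coincide as labelled edges if they agree up to inversion. For selfloops this means that
  the labels \<open>\<gamma>\<close> and \<open>-\<gamma>\<close> are identified, a selfloop being
  its own reversal.
\<close>

definition same_labelled_edge :: "('v, 'e) pre_digraph \<Rightarrow> ('e \<Rightarrow> int) \<Rightarrow> 'e \<Rightarrow> 'e \<Rightarrow> bool" where
  "same_labelled_edge G z e f \<longleftrightarrow>
     (tail G e = tail G f \<and> head G e = head G f \<and> z e = z f) \<or>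
     (tail G e = head G f \<and> head G e = tail G f \<and> z e = - z f)"

definition simple_labelling :: "('v, 'e) pre_digraph \<Rightarrow> ('e \<Rightarrow> int) \<Rightarrow> bool" where
  "simple_labelling G z \<longleftrightarrow>
     (\<forall>e\<in>arcs G. tail G e = head G e \<longrightarrow> z e \<noteq> 0) \<and>
     (\<forall>e\<in>arcs G. \<forall>f\<in>arcs G. e \<noteq> f \<longrightarrow> \<not> same_labelled_edge G z e f)"

definition Z_labelled_graph :: "('v, 'e) pre_digraph \<Rightarrow> ('e \<Rightarrow> int) \<Rightarrow> bool" where
  "Z_labelled_graph G z \<longleftrightarrow> fin_digraph G \<and> simple_labelling G z"

text \<open>
  The list \<open>vs\<close> holds the distinct vertices of the closed walk and \<open>es\<close> its edges, the
  \<open>t\<close>-th edge joining the \<open>t\<close>-th vertex to its cyclic successor in either direction. Distinctness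
  of the edges is only relevant for two vertices, where it prevents a single edge traversed back
  and forth from counting as a cycle.
\<close>

definition undirected_cycle :: "('v, 'e) pre_digraph \<Rightarrow> 'v list \<Rightarrow> 'e list \<Rightarrow> bool" where
  "undirected_cycle G vs es \<longleftrightarrow>
     vs \<noteq> [] \<and> length es = length vs \<and> distinct vs \<and> distinct es \<and>
     set vs \<subseteq> verts G \<and> set es \<subseteq> arcs G \<and>
     (\<forall>t<length vs. {tail G (es ! t), head G (es ! t)} = {vs ! t, vs ! (Suc t mod length vs)})"


subsection \<open>Isomorphism and minors\<close>

definition invert_edge :: "'e \<Rightarrow> ('v, 'e) zgraph \<Rightarrow> ('v, 'e) zgraph" where
  "invert_edge e = (\<lambda>(G, z).
     (G\<lparr>tail := (tail G)(e := head G e), head := (head G)(e := tail G e)\<rparr>, z(e := - z e)))"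

definition switch_vertex :: "'v \<Rightarrow> int \<Rightarrow> ('v, 'e) zgraph \<Rightarrow> ('v, 'e) zgraph" where
  "switch_vertex i \<gamma> = (\<lambda>(G, z).
     (G, \<lambda>e. if tail G e = i \<and> head G e \<noteq> i then z e + \<gamma>
             else if head G e = i \<and> tail G e \<noteq> i then z e - \<gamma>
             else z e))"

inductive relabel_step :: "('v, 'e) zgraph \<Rightarrow> ('v, 'e) zgraph \<Rightarrow> bool" where
  inversion: "e \<in> arcs G \<Longrightarrow> relabel_step (G, z) (invert_edge e (G, z))"
| switching: "i \<in> verts G \<Longrightarrow> relabel_step (G, z) (switch_vertex i \<gamma> (G, z))"

definition zgraph_isomorphic :: "('v, 'e) zgraph \<Rightarrow> ('w, 'f) zgraph \<Rightarrow> bool" where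
  "zgraph_isomorphic X Y \<longleftrightarrow>
     (\<exists>G z. relabel_step\<^sup>*\<^sup>* X (G, z) \<and>
       (case Y of (H, w) \<Rightarrow>
         (\<exists>f g. bij_betw f (verts G) (verts H) \<and> bij_betw g (arcs G) (arcs H) \<and>
           (\<forall>e\<in>arcs G. tail H (g e) = f (tail G e) \<and> head H (g e) = f (head G e) \<and>
              w (g e) = z e))))"

definition identify_ends :: "('v, 'e) pre_digraph \<Rightarrow> 'e \<Rightarrow> ('v, 'e) pre_digraph" where
  "identify_ends G e =
     (let c = (\<lambda>v. if v = head G e then tail G e else v)
      in \<lparr>verts = c ` verts G, arcs = arcs G - {e}, tail = c \<circ> tail G, head = c \<circ> head G\<rparr>)"

text \<open>
  \<open>A\<close> is the set of edges surviving the contraction of \<open>e\<close>: an edge may be dropped only if it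
  becomes a selfloop labelled \<open>0\<close> or coincides, as a labelled edge, with a surviving one.
\<close>

definition contraction_arcs ::
    "('v, 'e) pre_digraph \<Rightarrow> ('e \<Rightarrow> int) \<Rightarrow> 'e \<Rightarrow> 'e set \<Rightarrow> bool" where
  "contraction_arcs G z e A \<longleftrightarrow>
     (let H = identify_ends G e
      in A \<subseteq> arcs H \<and> simple_labelling (H\<lparr>arcs := A\<rparr>) z \<and>
         (\<forall>f\<in>arcs H - A. (tail H f = head H f \<and> z f = 0) \<or>
            (\<exists>g\<in>A. same_labelled_edge H z f g)))"

inductive minor_step :: "('v, 'e) zgraph \<Rightarrow> ('v, 'e) zgraph \<Rightarrow> bool" where
  relabel: "relabel_step X Y \<Longrightarrow> minor_step X Y"
| delete_edge: "e \<in> arcs G \<Longrightarrow> minor_step (G, z) (pre_digraph.del_arc G e, z)"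
| delete_vertex: "v \<in> verts G \<Longrightarrow> minor_step (G, z) (pre_digraph.del_vert G v, z)"
| contract: "\<lbrakk>e \<in> arcs G; tail G e \<noteq> head G e; z e = 0; contraction_arcs G z e A\<rbrakk>
     \<Longrightarrow> minor_step (G, z) ((identify_ends G e)\<lparr>arcs := A\<rparr>, z)"

text \<open>
  Inversions and switchings may be interleaved with deletions and contractions, since contraction
  requires an edge labelled \<open>0\<close>. Renaming vertices and edges commutes with all operations and
  is therefore needed only once, at the end.
\<close>

definition has_minor_isomorphic :: "('v, 'e) zgraph \<Rightarrow> ('w, 'f) zgraph \<Rightarrow> bool" where
  "has_minor_isomorphic X Y \<longleftrightarrow> (\<exists>X'. minor_step\<^sup>*\<^sup>* X X' \<and> zgraph_isomorphic X' Y)"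


subsection \<open>Special graphs, disjoint unions and 1-sums\<close>

definition complete_graph :: "nat \<Rightarrow> (nat, nat \<times> nat) pre_digraph" where
  "complete_graph k = \<lparr>verts = {1..k}, arcs = {(i, j). 1 \<le> i \<and> i < j \<and> j \<le> k}, tail = fst, head = snd\<rparr>"

definition K2_bullet :: "(nat, bool) pre_digraph" where
  "K2_bullet = \<lparr>verts = {1, 2}, arcs = UNIV, tail = (\<lambda>_. 1), head = (\<lambda>_. 2)\<rparr>"

definition is_union :: "('v, 'e) pre_digraph \<Rightarrow> ('v, 'e) pre_digraph \<Rightarrow> ('v, 'e) pre_digraph \<Rightarrow> bool" where
  "is_union G G1 G2 \<longleftrightarrow> subgraph G1 G \<and> subgraph G2 G \<and>
     verts G1 \<union> verts G2 = verts G \<and> arcs G1 \<union> arcs G2 = arcs G"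

definition is_disjoint_union :: "('v, 'e) pre_digraph \<Rightarrow> ('v, 'e) pre_digraph \<Rightarrow> ('v, 'e) pre_digraph \<Rightarrow> bool" where
  "is_disjoint_union G G1 G2 \<longleftrightarrow> is_union G G1 G2 \<and> verts G1 \<inter> verts G2 = {}"

definition is_one_sum :: "('v, 'e) pre_digraph \<Rightarrow> ('v, 'e) pre_digraph \<Rightarrow> ('v, 'e) pre_digraph \<Rightarrow> bool" where
  "is_one_sum G G1 G2 \<longleftrightarrow> is_union G G1 G2 \<and> (\<exists>v. verts G1 \<inter> verts G2 = {v})"

definition in_F :: "('v, 'e) pre_digraph \<Rightarrow> ('e \<Rightarrow> int) \<Rightarrow> bool" where
  "in_F G z \<longleftrightarrow> Z_labelled_graph G z \<and>
     (zgraph_isomorphic (G, z) (complete_graph 2, \<lambda>_. 0) \<or>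
      (\<exists>(H :: ('v, 'e) pre_digraph) w. Z_labelled_graph H w \<and> (\<exists>v. verts H = {v}) \<and>
         zgraph_isomorphic (G, z) (H, w)))"

text \<open>
  Graphs built from members of the family by disjoint unions and 1-sums. The null graph is included
  as the disjoint union of no graphs; on graphs with at least one vertex the first rule has no
  effect. Labels of summands are restrictions of \<open>z\<close>.
\<close>

inductive sum_of_F :: "('v, 'e) pre_digraph \<Rightarrow> ('e \<Rightarrow> int) \<Rightarrow> bool" where
  null: "Z_labelled_graph G z \<Longrightarrow> verts G = {} \<Longrightarrow> sum_of_F G z"
| base: "in_F G z \<Longrightarrow> sum_of_F G z"
| disjoint_union: "\<lbrakk>Z_labelled_graph G z; is_disjoint_union G G1 G2; sum_of_F G1 z; sum_of_F G2 z\<rbrakk>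
     \<Longrightarrow> sum_of_F G z"
| one_sum: "\<lbrakk>Z_labelled_graph G z; is_one_sum G G1 G2; sum_of_F G1 z; sum_of_F G2 z\<rbrakk>
     \<Longrightarrow> sum_of_F G z"


subsection \<open>Periodic frameworks and the realizable dimension\<close>

definition lift_verts :: "('v, 'e) pre_digraph \<Rightarrow> ('v \<times> int) set" where
  "lift_verts G = verts G \<times> UNIV"

definition lift_edges :: "('v, 'e) pre_digraph \<Rightarrow> ('e \<Rightarrow> int) \<Rightarrow> ('v \<times> int) set set" where
  "lift_edges G z = {{(tail G e, \<gamma>), (head G e, \<gamma> + z e)} |e \<gamma>. e \<in> arcs G}"

text \<open>
  The dimension varies inside the definitions below, so vectors of \<open>d\<close>-dimensional Euclidean
  space are functions on \<^typ>\<open>nat\<close> vanishing from index \<open>d\<close> on.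
\<close>

abbreviation R_space :: "nat \<Rightarrow> (nat \<Rightarrow> real) set" where
  "R_space d \<equiv> topspace (Euclidean_space d)"

abbreviation vec_length :: "nat \<Rightarrow> (nat \<Rightarrow> real) \<Rightarrow> real" where
  "vec_length d x \<equiv> L2_set x {..<d}"

definition periodic_framework ::
    "('v, 'e) pre_digraph \<Rightarrow> nat \<Rightarrow> (nat \<Rightarrow> real) \<Rightarrow> ('v \<times> int \<Rightarrow> nat \<Rightarrow> real) \<Rightarrow> bool" where
  "periodic_framework G d l p \<longleftrightarrow>
     l \<in> R_space d \<and> l \<noteq> (\<lambda>_. 0) \<and>
     (\<forall>x\<in>lift_verts G. p x \<in> R_space d) \<and>
     (\<forall>i \<gamma>. (i, \<gamma>) \<in> lift_verts G \<longrightarrow> p (i, \<gamma> + 1) - p (i, \<gamma>) = l)"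

definition equivalent_frameworks ::
    "('v, 'e) pre_digraph \<Rightarrow> ('e \<Rightarrow> int) \<Rightarrow>
     nat \<Rightarrow> (nat \<Rightarrow> real) \<Rightarrow> ('v \<times> int \<Rightarrow> nat \<Rightarrow> real) \<Rightarrow>
     nat \<Rightarrow> (nat \<Rightarrow> real) \<Rightarrow> ('v \<times> int \<Rightarrow> nat \<Rightarrow> real) \<Rightarrow> bool" where
  "equivalent_frameworks G z d l p d' l' p' \<longleftrightarrow>
     (\<forall>x y. {x, y} \<in> lift_edges G z \<longrightarrow>
        vec_length d (p x - p y) = vec_length d' (p' x - p' y)) \<and>
     vec_length d l = vec_length d' l'"

definition realizable :: "nat \<Rightarrow> ('v, 'e) pre_digraph \<Rightarrow> ('e \<Rightarrow> int) \<Rightarrow> bool" where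
  "realizable d G z \<longleftrightarrow>
     (\<forall>d' l' p'. periodic_framework G d' l' p' \<longrightarrow>
        (\<exists>l p. periodic_framework G d l p \<and> equivalent_frameworks G z d' l' p' d l p))"

definition rd :: "('v, 'e) pre_digraph \<Rightarrow> ('e \<Rightarrow> int) \<Rightarrow> enat" where
  "rd G z = (INF d\<in>{d. realizable d G z}. enat d)"

end

theory Submission
  imports Defs
begin

text \<open>
  The implications run (i), (ii), (iv), (iii), (i). Realizability in a fixed dimension passes to
  minors, because a framework of a contraction is one of the original graph with an edge of length
  0, and neither an equilateral triangle nor two equally long parallel edges attached off the
  lattice line fit on a line. A cycle becomes a forbidden minor by deleting everything else and
  repeatedly switching an edge to label 0 and contracting it; the sum of the labels around the cycle
  decides between the triangle and the parallel edges. In a graph without nontrivial cycles an end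
  of a longest path meets at most one non-loop edge, so the graph is a disjoint union or 1-sum of
  smaller graphs of the same kind, and placements of the summands can be glued after a reflection
  that aligns their lattice vectors and a translation.
\<close>

subsection \<open>Reflections in coordinate space\<close>

lemma L2_set_cmult: "L2_set (\<lambda>k. c * x k) A = \<bar>c\<bar> * L2_set x A"
  by (simp add: L2_set_def power_mult_distrib real_sqrt_mult flip: sum_distrib_left)

lemma vec_length_Suc_0: "vec_length (Suc 0) x = \<bar>x 0\<bar>"
  by (simp add: L2_set_def)

text \<open>If \<open>u\<close> vanishes below \<open>d\<close>, the division by 0 makes this the identity.\<close>
definition reflect :: "nat \<Rightarrow> (nat \<Rightarrow> real) \<Rightarrow> (nat \<Rightarrow> real) \<Rightarrow> nat \<Rightarrow> real" where
  "reflect d u x = (\<lambda>k. x k - 2 * (\<Sum>i<d. u i * x i) / (\<Sum>i<d. (u i)\<^sup>2) * u k)"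

lemma reflect_linear:
  "reflect d u (\<lambda>k. x k - y k + c * w k) =
   (\<lambda>k. reflect d u x k - reflect d u y k + c * reflect d u w k)"
proof -
  have "(\<Sum>i<d. u i * (x i - y i + c * w i)) =
      (\<Sum>i<d. u i * x i) - (\<Sum>i<d. u i * y i) + c * (\<Sum>i<d. u i * w i)"
    by (simp add: algebra_simps sum.distrib sum_subtractf sum_distrib_left)
  then show ?thesis
    unfolding reflect_def
    by (simp only:) (simp add: add_divide_distrib diff_divide_distrib algebra_simps)
qed

lemma vec_length_reflect: "vec_length d (reflect d u x) = vec_length d x"
proof -
  define s t where "s = (\<Sum>i<d. (u i)\<^sup>2)" and "t = (\<Sum>i<d. u i * x i)"
  define c where "c = 2 * t / s"
  have "(\<Sum>i<d. (x i - c * u i)\<^sup>2) = (\<Sum>i<d. (x i)\<^sup>2) - 2 * c * t + c\<^sup>2 * s"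
    unfolding s_def t_def
    by (simp add: power2_diff power_mult_distrib sum.distrib sum_subtractf sum_distrib_left
        mult_ac)
  also have "\<dots> = (\<Sum>i<d. (x i)\<^sup>2)"
    by (cases "s = 0") (simp_all add: c_def power2_eq_square)
  finally show ?thesis
    by (simp add: L2_set_def reflect_def c_def s_def t_def)
qed

lemma reflect_diff_eq:
  assumes "vec_length d a = vec_length d b" "k < d"
  shows "reflect d (\<lambda>i. a i - b i) a k = b k"
proof -
  define s where "s = (\<Sum>i<d. (a i - b i)\<^sup>2)"
  have "2 * (\<Sum>i<d. (a i - b i) * a i) = (\<Sum>i<d. (a i - b i)\<^sup>2 + ((a i)\<^sup>2 - (b i)\<^sup>2))"
    unfolding sum_distrib_left by (intro sum.cong) (simp_all add: power2_eq_square algebra_simps)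
  also have "\<dots> = s"
    using assms(1) by (simp add: sum.distrib sum_subtractf s_def L2_set_def)
  finally have twice_inner: "2 * (\<Sum>i<d. (a i - b i) * a i) = s" .
  show ?thesis
  proof (cases "s = 0")
    case True
    then have "a k - b k = 0"
      using assms(2) by (simp add: s_def sum_nonneg_eq_0_iff)
    then show ?thesis
      by (simp add: reflect_def)
  next
    case False
    then show ?thesis
      by (simp add: reflect_def twice_inner flip: s_def)
  qed
qed

subsection \<open>Placements of the vertices\<close>

text \<open>By periodicity a framework is determined by its points \<open>q\<close> at level 0 and its lattice
  vector.\<close>

definition arc_displacement ::
    "('v, 'e) pre_digraph \<Rightarrow> ('e \<Rightarrow> int) \<Rightarrow>
     (nat \<Rightarrow> real) \<Rightarrow> ('v \<Rightarrow> nat \<Rightarrow> real) \<Rightarrow> 'e \<Rightarrow> nat \<Rightarrow> real" where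
  "arc_displacement G z l q e = (\<lambda>k. q (head G e) k - q (tail G e) k + z e * l k)"

definition equivalent_placements ::
    "('v, 'e) pre_digraph \<Rightarrow> ('e \<Rightarrow> int) \<Rightarrow>
     nat \<Rightarrow> (nat \<Rightarrow> real) \<Rightarrow> ('v \<Rightarrow> nat \<Rightarrow> real) \<Rightarrow>
     nat \<Rightarrow> (nat \<Rightarrow> real) \<Rightarrow> ('v \<Rightarrow> nat \<Rightarrow> real) \<Rightarrow> bool" where
  "equivalent_placements G z d l q d' l' q' \<longleftrightarrow>
     (\<forall>e\<in>arcs G. vec_length d (arc_displacement G z l q e) =
        vec_length d' (arc_displacement G z l' q' e)) \<and>
     vec_length d l = vec_length d' l'"

definition placement_realizable :: "nat \<Rightarrow> ('v, 'e) pre_digraph \<Rightarrow> ('e \<Rightarrow> int) \<Rightarrow> bool" where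
  "placement_realizable d G z \<longleftrightarrow>
     (\<forall>d' l' q'. vec_length d' l' \<noteq> 0 \<longrightarrow> (\<exists>l q. equivalent_placements G z d' l' q' d l q))"

lemma equivalent_placements_trans:
  "equivalent_placements G z d l q d' l' q' \<Longrightarrow>
   equivalent_placements G z d' l' q' d'' l'' q'' \<Longrightarrow>
   equivalent_placements G z d l q d'' l'' q''"
  by (simp add: equivalent_placements_def)

lemma equivalent_placements_truncate:
  assumes "d \<le> d'"
  shows "equivalent_placements G z d l q d' (\<lambda>k. if k < d then l k else 0)
    (\<lambda>i k. if k < d then q i k else 0)"
proof -
  have len: "vec_length d y = vec_length d' x" if "\<And>k. x k = (if k < d then y k else 0)" for x y
  proof -
    have "(\<Sum>k<d'. (x k)\<^sup>2) = (\<Sum>k<d. (y k)\<^sup>2)"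
      using assms by (intro sum.mono_neutral_cong_right) (auto simp: that)
    then show ?thesis by (simp add: L2_set_def)
  qed
  then show ?thesis
    unfolding equivalent_placements_def arc_displacement_def by (intro conjI ballI len) auto
qed

lemma placement_realizable_mono:
  assumes "d \<le> d'" "placement_realizable d G z"
  shows "placement_realizable d' G z"
  using assms equivalent_placements_truncate equivalent_placements_trans
  unfolding placement_realizable_def by meson

lemma equivalent_placements_reflect:
  "equivalent_placements G z d l q d (reflect d u l) (reflect d u \<circ> q)"
  by (simp add: equivalent_placements_def arc_displacement_def vec_length_reflect
      flip: reflect_linear)

lemma ex_equivalent_placement_with_lattice_vector:
  assumes "equivalent_placements G z d l q d' l1 q1" "vec_length d' l2 = vec_length d l"
  shows "\<exists>q2. equivalent_placements G z d l q d' l2 q2"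
proof -
  let ?R = "reflect d' (\<lambda>i. l1 i - l2 i)"
  have "vec_length d' l1 = vec_length d' l2"
    using assms by (simp add: equivalent_placements_def)
  then have "?R l1 k = l2 k" if "k < d'" for k
    using that by (rule reflect_diff_eq)
  then have "equivalent_placements G z d' (?R l1) (?R \<circ> q1) d' l2 (?R \<circ> q1)"
    by (auto simp: equivalent_placements_def arc_displacement_def intro!: L2_set_cong)
  from equivalent_placements_trans[OF equivalent_placements_reflect this]
  show ?thesis
    using equivalent_placements_trans[OF assms(1)] by blast
qed

subsection \<open>The realizable dimension in terms of placements\<close>

lemma periodic_framework_shift:
  assumes "periodic_framework G d l p" "i \<in> verts G"
  shows "p (i, \<gamma>) k = p (i, 0) k + of_int \<gamma> * l k"
proof -
  have step: "p (i, \<gamma> + 1) k = p (i, \<gamma>) k + l k" for \<gamma>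
  proof -
    have "p (i, \<gamma> + 1) - p (i, \<gamma>) = l"
      using assms by (auto simp: periodic_framework_def lift_verts_def)
    then show ?thesis
      by (auto simp: fun_eq_iff algebra_simps dest: spec[of _ k])
  qed
  show ?thesis
  proof (induction \<gamma> rule: int_induct[where k = 0])
    case (step1 \<gamma>)
    then show ?case by (simp add: step distrib_right)
  next
    case (step2 \<gamma>)
    then show ?case using step[of "\<gamma> - 1"] by (simp add: left_diff_distrib)
  qed simp
qed

lemma periodic_framework_lattice_vector_nonzero:
  "periodic_framework G d l p \<Longrightarrow> vec_length d l \<noteq> 0"
  by (auto simp: periodic_framework_def L2_set_eq_0_iff topspace_Euclidean_space fun_eq_iff)
    (metis lessThan_iff not_le)

lemma equivalent_frameworks_iff_placements:
  assumes "wf_digraph G" and p: "periodic_framework G d l p" and p': "periodic_framework G d' l' p'"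
  shows "equivalent_frameworks G z d l p d' l' p' \<longleftrightarrow>
    equivalent_placements G z d l (\<lambda>i. p (i, 0)) d' l' (\<lambda>i. p' (i, 0))"
proof -
  interpret wf_digraph G by fact
  have disp: "p (head G e, \<gamma> + z e) - p (tail G e, \<gamma>) = arc_displacement G z l (\<lambda>i. p (i, 0)) e"
    if "periodic_framework G d l p" "e \<in> arcs G" for d l p e \<gamma>
    using that periodic_framework_shift[OF that(1), of "head G e" "\<gamma> + z e"]
      periodic_framework_shift[OF that(1), of "tail G e" \<gamma>]
    by (simp add: fun_eq_iff arc_displacement_def algebra_simps)
  have sym: "vec_length d (x - y) = vec_length d (y - x)" for d x y
    by (simp add: L2_set_def power2_commute)
  have "(\<forall>x y. {x, y} \<in> lift_edges G z \<longrightarrow>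
       vec_length d (p x - p y) = vec_length d' (p' x - p' y)) \<longleftrightarrow>
    (\<forall>e\<in>arcs G. \<forall>\<gamma>. vec_length d (p (head G e, \<gamma> + z e) - p (tail G e, \<gamma>)) =
       vec_length d' (p' (head G e, \<gamma> + z e) - p' (tail G e, \<gamma>)))"
    unfolding lift_edges_def by (fastforce simp: doubleton_eq_iff sym)
  then show ?thesis
    by (simp add: equivalent_frameworks_def equivalent_placements_def disp[OF p] disp[OF p'])
qed

lemma ex_periodic_framework_of_placement:
  assumes "vec_length d l \<noteq> 0"
  shows "\<exists>l' p. periodic_framework G d l' p \<and>
    equivalent_placements G z d l q d l' (\<lambda>i. p (i, 0))"
proof (intro exI conjI)
  let ?l = "\<lambda>k. if k < d then l k else 0"
  let ?p = "\<lambda>(i, \<gamma>) k. if k < d then q i k + of_int \<gamma> * l k else 0"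
  show "equivalent_placements G z d l q d ?l (\<lambda>i. ?p (i, 0))"
    using equivalent_placements_truncate[of d d] by (simp cong: if_cong)
  have "\<exists>k<d. l k \<noteq> 0"
    using assms by (auto simp: L2_set_eq_0_iff)
  then have "?l \<noteq> (\<lambda>_. 0)"
    by (auto simp: fun_eq_iff)
  then show "periodic_framework G d ?l ?p"
    by (auto simp: periodic_framework_def topspace_Euclidean_space algebra_simps)
qed

lemma realizable_imp_placement_realizable:
  assumes wf: "wf_digraph G" and real: "realizable d G z"
  shows "placement_realizable d G z"
  unfolding placement_realizable_def
proof (intro allI impI)
  fix d' l' and q' :: "_ \<Rightarrow> nat \<Rightarrow> real"
  assume "vec_length d' l' \<noteq> 0"
  then obtain l1 p1 where p1: "periodic_framework G d' l1 p1"
    and eq1: "equivalent_placements G z d' l' q' d' l1 (\<lambda>i. p1 (i, 0))"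
    using ex_periodic_framework_of_placement by blast
  obtain l p where p: "periodic_framework G d l p"
    and eq: "equivalent_frameworks G z d' l1 p1 d l p"
    using real p1 unfolding realizable_def by blast
  then have "equivalent_placements G z d' l1 (\<lambda>i. p1 (i, 0)) d l (\<lambda>i. p (i, 0))"
    by (simp add: equivalent_frameworks_iff_placements[OF wf p1 p])
  from equivalent_placements_trans[OF eq1 this]
  show "\<exists>l q. equivalent_placements G z d' l' q' d l q"
    by blast
qed

lemma placement_realizable_imp_realizable:
  assumes wf: "wf_digraph G" and real: "placement_realizable d G z"
  shows "realizable d G z"
  unfolding realizable_def
proof (intro allI impI)
  fix d' l' p'
  assume p': "periodic_framework G d' l' p'"
  then have l': "vec_length d' l' \<noteq> 0"
    by (rule periodic_framework_lattice_vector_nonzero)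
  then obtain l q where eq: "equivalent_placements G z d' l' (\<lambda>i. p' (i, 0)) d l q"
    using real unfolding placement_realizable_def by blast
  then have "vec_length d l \<noteq> 0"
    using l' by (simp add: equivalent_placements_def)
  then obtain l1 p where p: "periodic_framework G d l1 p"
    and eq1: "equivalent_placements G z d l q d l1 (\<lambda>i. p (i, 0))"
    using ex_periodic_framework_of_placement by blast
  show "\<exists>l p. periodic_framework G d l p \<and> equivalent_frameworks G z d' l' p' d l p"
    using p equivalent_frameworks_iff_placements[OF wf p' p]
      equivalent_placements_trans[OF eq eq1] by blast
qed

lemma rd_le_iff_placement_realizable:
  assumes "wf_digraph G"
  shows "rd G z \<le> enat d \<longleftrightarrow> placement_realizable d G z"
proof
  let ?D = "{d'. realizable d' G z}"
  assume rd_le: "rd G z \<le> enat d"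
  have "enat ` ?D \<noteq> {}"
  proof
    assume "enat ` ?D = {}"
    then show False
      using rd_le by (simp add: rd_def Inf_enat_def)
  qed
  then have "rd G z \<in> enat ` ?D"
    unfolding rd_def by (metis wellorder_InfI ex_in_conv)
  then obtain d' where "rd G z = enat d'" "realizable d' G z"
    by blast
  with rd_le have "d' \<le> d" "placement_realizable d' G z"
    using assms realizable_imp_placement_realizable by auto
  then show "placement_realizable d G z"
    by (rule placement_realizable_mono)
next
  assume "placement_realizable d G z"
  then show "rd G z \<le> enat d"
    using assms unfolding rd_def
    by (auto intro: INF_lower placement_realizable_imp_realizable)
qed

subsection \<open>Relabelling and minors\<close>

definition switch_labels ::
    "('v \<Rightarrow> int) \<Rightarrow> ('v, 'e) pre_digraph \<Rightarrow> ('e \<Rightarrow> int) \<Rightarrow> 'e \<Rightarrow> int" where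
  "switch_labels s G z = (\<lambda>e. z e + s (tail G e) - s (head G e))"

definition reverse_arcs :: "'e set \<Rightarrow> ('v, 'e) pre_digraph \<Rightarrow> ('v, 'e) pre_digraph" where
  "reverse_arcs B G = G\<lparr>tail := \<lambda>e. if e \<in> B then head G e else tail G e,
     head := \<lambda>e. if e \<in> B then tail G e else head G e\<rparr>"

definition negate_labels :: "'e set \<Rightarrow> ('e \<Rightarrow> int) \<Rightarrow> 'e \<Rightarrow> int" where
  "negate_labels B z = (\<lambda>e. if e \<in> B then - z e else z e)"

lemma reverse_arcs_simps [simp]:
  "verts (reverse_arcs B G) = verts G"
  "arcs (reverse_arcs B G) = arcs G"
  "tail (reverse_arcs B G) e = (if e \<in> B then head G e else tail G e)"
  "head (reverse_arcs B G) e = (if e \<in> B then tail G e else head G e)"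
  by (simp_all add: reverse_arcs_def)

lemma switch_vertex_eq:
  "switch_vertex i \<gamma> (G, z) = (G, switch_labels (\<lambda>v. if v = i then \<gamma> else 0) G z)"
  by (auto simp: switch_vertex_def switch_labels_def)

lemma invert_edge_eq: "invert_edge e (G, z) = (reverse_arcs {e} G, negate_labels {e} z)"
  by (auto simp: invert_edge_def reverse_arcs_def negate_labels_def intro!: pre_digraph.equality)

lemma relabel_steps_switch_labels:
  assumes "finite S" "S \<subseteq> verts G" "\<And>v. v \<notin> S \<Longrightarrow> s v = 0"
  shows "relabel_step\<^sup>*\<^sup>* (G, z) (G, switch_labels s G z)"
  using assms
proof (induction S arbitrary: s rule: finite_induct)
  case empty
  then show ?case by (simp add: switch_labels_def)
next
  case (insert i S)
  have "relabel_step\<^sup>*\<^sup>* (G, z) (G, switch_labels (s(i := 0)) G z)"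
    using insert by (intro insert.IH) auto
  also have "relabel_step (G, switch_labels (s(i := 0)) G z)
      (switch_vertex i (s i) (G, switch_labels (s(i := 0)) G z))"
    using insert.prems by (intro relabel_step.switching) simp
  also have "switch_vertex i (s i) (G, switch_labels (s(i := 0)) G z) = (G, switch_labels s G z)"
    by (auto simp: switch_vertex_eq switch_labels_def)
  finally show ?case .
qed

lemma relabel_steps_reverse_arcs:
  assumes "finite B" "B \<subseteq> arcs G"
  shows "relabel_step\<^sup>*\<^sup>* (G, z) (reverse_arcs B G, negate_labels B z)"
  using assms
proof (induction B rule: finite_induct)
  case empty
  then show ?case by (simp add: reverse_arcs_def negate_labels_def)
next
  case (insert e B)
  have "relabel_step\<^sup>*\<^sup>* (G, z) (reverse_arcs B G, negate_labels B z)"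
    using insert by simp
  also have "relabel_step (reverse_arcs B G, negate_labels B z)
      (invert_edge e (reverse_arcs B G, negate_labels B z))"
    using insert.prems by (intro relabel_step.inversion) simp
  also have "invert_edge e (reverse_arcs B G, negate_labels B z) =
      (reverse_arcs (insert e B) G, negate_labels (insert e B) z)"
    using insert.hyps
    by (auto simp: invert_edge_eq reverse_arcs_def negate_labels_def intro!: pre_digraph.equality)
  finally show ?case .
qed

lemma simple_labelling_reverse_arcs:
  assumes "simple_labelling G z"
  shows "simple_labelling (reverse_arcs B G) (negate_labels B z)"
proof -
  have "same_labelled_edge (reverse_arcs B G) (negate_labels B z) = same_labelled_edge G z"
    by (auto simp: fun_eq_iff same_labelled_edge_def negate_labels_def)
  then show ?thesis
    using assms by (auto simp: simple_labelling_def negate_labels_def)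
qed

definition zgraph_renaming ::
    "('v \<Rightarrow> 'w) \<Rightarrow> ('e \<Rightarrow> 'f) \<Rightarrow> ('v, 'e) zgraph \<Rightarrow> ('w, 'f) zgraph \<Rightarrow> bool" where
  "zgraph_renaming f g = (\<lambda>(G, z) (H, w).
     bij_betw f (verts G) (verts H) \<and> bij_betw g (arcs G) (arcs H) \<and>
     (\<forall>e\<in>arcs G. tail H (g e) = f (tail G e) \<and> head H (g e) = f (head G e) \<and> w (g e) = z e))"

lemma zgraph_isomorphic_iff_renaming:
  "zgraph_isomorphic X Y \<longleftrightarrow> (\<exists>X' f g. relabel_step\<^sup>*\<^sup>* X X' \<and> zgraph_renaming f g X' Y)"
  unfolding zgraph_isomorphic_def zgraph_renaming_def by (cases Y) fastforce

lemma relabel_steps_imp_minor_steps: "relabel_step\<^sup>*\<^sup>* X Y \<Longrightarrow> minor_step\<^sup>*\<^sup>* X Y"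
  by (rule rtranclp_mono[THEN predicate2D, rotated]) (auto intro: minor_step.relabel)

lemma has_minor_isomorphic_iff_renaming:
  "has_minor_isomorphic X Y \<longleftrightarrow> (\<exists>X' f g. minor_step\<^sup>*\<^sup>* X X' \<and> zgraph_renaming f g X' Y)"
  unfolding has_minor_isomorphic_def zgraph_isomorphic_iff_renaming
  by (meson relabel_steps_imp_minor_steps rtranclp.rtrancl_refl rtranclp_trans)

lemma minor_steps_delete_arcs:
  assumes "finite B" "B \<subseteq> arcs G"
  shows "minor_step\<^sup>*\<^sup>* (G, z) (G\<lparr>arcs := arcs G - B\<rparr>, z)"
  using assms
proof (induction B rule: finite_induct)
  case (insert e B)
  have "minor_step (G\<lparr>arcs := arcs G - B\<rparr>, z) (pre_digraph.del_arc (G\<lparr>arcs := arcs G - B\<rparr>) e, z)"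
    using insert by (intro minor_step.delete_edge) auto
  moreover have "pre_digraph.del_arc (G\<lparr>arcs := arcs G - B\<rparr>) e = G\<lparr>arcs := arcs G - insert e B\<rparr>"
    by (auto simp: pre_digraph.del_arc_def intro!: pre_digraph.equality)
  ultimately show ?case
    using insert by (auto intro: rtranclp.rtrancl_into_rtrancl)
qed simp

lemma minor_steps_delete_isolated_verts:
  assumes "finite B" "B \<subseteq> verts G" "\<And>e. e \<in> arcs G \<Longrightarrow> tail G e \<notin> B \<and> head G e \<notin> B"
  shows "minor_step\<^sup>*\<^sup>* (G, z) (G\<lparr>verts := verts G - B\<rparr>, z)"
  using assms
proof (induction B rule: finite_induct)
  case (insert v B)
  have "minor_step (G\<lparr>verts := verts G - B\<rparr>, z)
      (pre_digraph.del_vert (G\<lparr>verts := verts G - B\<rparr>) v, z)"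
    using insert by (intro minor_step.delete_vertex) auto
  moreover have "pre_digraph.del_vert (G\<lparr>verts := verts G - B\<rparr>) v =
      G\<lparr>verts := verts G - insert v B\<rparr>"
    using insert.prems(2) by (auto simp: pre_digraph.del_vert_def intro!: pre_digraph.equality)
  ultimately show ?case
    using insert by (auto intro: rtranclp.rtrancl_into_rtrancl)
qed simp

lemma minor_steps_subgraph:
  assumes "fin_digraph G" "subgraph H G"
  shows "minor_step\<^sup>*\<^sup>* (G, z) (H, z)"
proof -
  interpret G: fin_digraph G by fact
  have H: "wf_digraph H" "verts H \<subseteq> verts G" "arcs H \<subseteq> arcs G" "tail H = tail G" "head H = head G"
    using assms(2) by (auto simp: subgraph_def compatible_def)
  define K where "K = G\<lparr>arcs := arcs H\<rparr>"
  have "minor_step\<^sup>*\<^sup>* (G, z) (K, z)"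
    using minor_steps_delete_arcs[of "arcs G - arcs H" G] H(3) by (simp add: K_def double_diff)
  also have "minor_step\<^sup>*\<^sup>* (K, z) (K\<lparr>verts := verts H\<rparr>, z)"
    using minor_steps_delete_isolated_verts[of "verts G - verts H" K] H
    by (auto simp: K_def double_diff wf_digraph_def)
  also have "K\<lparr>verts := verts H\<rparr> = H"
    using H by (simp add: K_def)
  finally show ?thesis .
qed

lemma minor_step_wf_digraph:
  assumes "minor_step X Y" "wf_digraph (fst X)"
  shows "wf_digraph (fst Y)"
  using assms
proof (induction rule: minor_step.induct)
  case (relabel X Y)
  then show ?case
    by (induction rule: relabel_step.induct)
      (auto simp: wf_digraph_def invert_edge_eq switch_vertex_eq)
next
  case (delete_edge e G z)
  then show ?case by (simp add: wf_digraph.wf_digraph_del_arc)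
next
  case (delete_vertex v G z)
  then show ?case by (simp add: wf_digraph.wf_digraph_del_vert)
next
  case (contract e G z A)
  then show ?case
    by (auto simp: wf_digraph_def contraction_arcs_def identify_ends_def Let_def)
qed

subsection \<open>Realizability is closed under minors\<close>

lemma equivalent_placements_reverse_arcs:
  "equivalent_placements (reverse_arcs B G) (negate_labels B z) = equivalent_placements G z"
proof -
  have "arc_displacement (reverse_arcs B G) (negate_labels B z) l q e =
      (\<lambda>k. (if e \<in> B then - 1 else 1) * arc_displacement G z l q e k)" for l q e
    by (simp add: fun_eq_iff arc_displacement_def negate_labels_def)
  then have "vec_length d (arc_displacement (reverse_arcs B G) (negate_labels B z) l q e) =
      vec_length d (arc_displacement G z l q e)" for d l q e
    by (simp only: L2_set_cmult) simp
  then show ?thesis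
    by (simp add: fun_eq_iff equivalent_placements_def)
qed

lemma equivalent_placements_switch_labels:
  "equivalent_placements G (switch_labels s G z) d l q d' l' q' \<longleftrightarrow>
   equivalent_placements G z d l (\<lambda>v k. q v k - real_of_int (s v) * l k)
     d' l' (\<lambda>v k. q' v k - real_of_int (s v) * l' k)"
proof -
  have "arc_displacement G (switch_labels s G z) l q =
      arc_displacement G z l (\<lambda>v k. q v k - real_of_int (s v) * l k)"
    for l :: "nat \<Rightarrow> real" and q
    by (simp add: fun_eq_iff arc_displacement_def switch_labels_def algebra_simps)
  then show ?thesis
    by (simp add: equivalent_placements_def)
qed

lemma placement_realizable_switch_labels:
  assumes "placement_realizable m G z"
  shows "placement_realizable m G (switch_labels s G z)"
  unfolding placement_realizable_def equivalent_placements_switch_labels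
proof (intro allI impI)
  fix d l and q :: "_ \<Rightarrow> nat \<Rightarrow> real"
  assume "vec_length d l \<noteq> 0"
  then obtain l' q' where
    "equivalent_placements G z d l (\<lambda>v k. q v k - real_of_int (s v) * l k) m l' q'"
    using assms unfolding placement_realizable_def by blast
  then show "\<exists>l' q'. equivalent_placements G z d l (\<lambda>v k. q v k - real_of_int (s v) * l k)
      m l' (\<lambda>v k. q' v k - real_of_int (s v) * l' k)"
    by (intro exI[of _ l'] exI[of _ "\<lambda>v k. q' v k + real_of_int (s v) * l' k"]) simp
qed

lemma placement_realizable_arcs_mono:
  assumes "placement_realizable m G z" "arcs H \<subseteq> arcs G" "tail H = tail G" "head H = head G"
  shows "placement_realizable m H z"
proof -
  have "equivalent_placements H z d l q m l' q'" if "equivalent_placements G z d l q m l' q'"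
    for d l q l' q'
    using assms(2-4) that by (auto simp: equivalent_placements_def arc_displacement_def)
  then show ?thesis
    using assms(1) unfolding placement_realizable_def by meson
qed

text \<open>The contracted edge has length 0 in a framework pulled back from the contraction, so every
  equivalent framework places its ends at the same point.\<close>
lemma placement_realizable_contract:
  assumes G: "placement_realizable m G z" and e: "e \<in> arcs G" "z e = 0"
    and A: "A \<subseteq> arcs (identify_ends G e)"
  shows "placement_realizable m ((identify_ends G e)\<lparr>arcs := A\<rparr>) z"
  unfolding placement_realizable_def
proof (intro allI impI)
  let ?H = "(identify_ends G e)\<lparr>arcs := A\<rparr>"
  define c where "c v = (if v = head G e then tail G e else v)" for v
  have H: "A \<subseteq> arcs G" "tail ?H = c \<circ> tail G" "head ?H = c \<circ> head G"
    using A by (auto simp: identify_ends_def Let_def c_def)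
  fix d l and q :: "_ \<Rightarrow> nat \<Rightarrow> real"
  assume "vec_length d l \<noteq> 0"
  then obtain l' q' where eq: "equivalent_placements G z d l (q \<circ> c) m l' q'"
    using G unfolding placement_realizable_def by blast
  have "arc_displacement G z l (q \<circ> c) e = (\<lambda>_. 0)"
    using e(2) by (simp add: arc_displacement_def c_def)
  then have "vec_length m (arc_displacement G z l' q' e) = 0"
    using eq e(1) unfolding equivalent_placements_def by (metis L2_set_0')
  then have "q' (head G e) k = q' (tail G e) k" if "k < m" for k
    using that e(2) by (simp add: L2_set_eq_0_iff arc_displacement_def)
  then have "q' (c v) k = q' v k" if "k < m" for v k
    using that by (simp add: c_def)
  then have "vec_length m (arc_displacement ?H z l' q' f) =
      vec_length m (arc_displacement G z l' q' f)" for f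
    by (intro L2_set_cong) (simp_all add: arc_displacement_def H)
  moreover have "arc_displacement ?H z l q = arc_displacement G z l (q \<circ> c)"
    by (simp add: fun_eq_iff arc_displacement_def H)
  ultimately have "equivalent_placements ?H z d l q m l' q'"
    using eq H(1) by (auto simp: equivalent_placements_def)
  then show "\<exists>l' q'. equivalent_placements ?H z d l q m l' q'"
    by blast
qed

lemma placement_realizable_minor_step:
  assumes "minor_step X Y" "placement_realizable m (fst X) (snd X)"
  shows "placement_realizable m (fst Y) (snd Y)"
  using assms
proof (induction rule: minor_step.induct)
  case (relabel X Y)
  then show ?case
  proof (induction rule: relabel_step.induct)
    case (inversion e G z)
    then show ?case
      by (simp add: invert_edge_eq placement_realizable_def equivalent_placements_reverse_arcs)
  next
    case (switching i G z \<gamma>)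
    then show ?case
      by (simp add: switch_vertex_eq placement_realizable_switch_labels)
  qed
next
  case (delete_edge e G z)
  then show ?case
    by (auto simp: pre_digraph.del_arc_def elim!: placement_realizable_arcs_mono)
next
  case (delete_vertex v G z)
  then show ?case
    by (auto simp: pre_digraph.del_vert_def elim!: placement_realizable_arcs_mono)
next
  case (contract e G z A)
  then show ?case
    by (auto simp: contraction_arcs_def Let_def intro!: placement_realizable_contract)
qed

lemma placement_realizable_renaming:
  assumes ren: "zgraph_renaming f g (G, z) (H, w)" and wf: "wf_digraph G"
    and G: "placement_realizable m G z"
  shows "placement_realizable m H w"
  unfolding placement_realizable_def
proof (intro allI impI)
  define h where "h = the_inv_into (verts G) f"
  have h_f: "h (f v) = v" if "v \<in> verts G" for v
    using ren that by (simp add: zgraph_renaming_def h_def bij_betw_def the_inv_into_f_f)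
  fix d l and q :: "_ \<Rightarrow> nat \<Rightarrow> real"
  assume "vec_length d l \<noteq> 0"
  then obtain l' q' where eq: "equivalent_placements G z d l (q \<circ> f) m l' q'"
    using G unfolding placement_realizable_def by blast
  have "arcs H = g ` arcs G"
    using ren by (auto simp: zgraph_renaming_def bij_betw_def)
  moreover have "arc_displacement H w l q (g e) = arc_displacement G z l (q \<circ> f) e"
    "arc_displacement H w l' (q' \<circ> h) (g e) = arc_displacement G z l' q' e" if "e \<in> arcs G" for e
    using ren wf h_f that by (auto simp: zgraph_renaming_def arc_displacement_def wf_digraph_def)
  ultimately have "equivalent_placements H w d l q m l' (q' \<circ> h)"
    using eq by (simp add: equivalent_placements_def)
  then show "\<exists>l' q'. equivalent_placements H w d l q m l' q'"
    by blast
qed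

lemma placement_realizable_minor:
  assumes "has_minor_isomorphic (G, z) (H, w)" "wf_digraph G" "placement_realizable m G z"
  shows "placement_realizable m H w"
proof -
  obtain G' z' f g where minor: "minor_step\<^sup>*\<^sup>* (G, z) (G', z')"
    and ren: "zgraph_renaming f g (G', z') (H, w)"
    using assms(1) unfolding has_minor_isomorphic_iff_renaming by auto
  from minor have "wf_digraph (fst (G', z')) \<and> placement_realizable m (fst (G', z')) (snd (G', z'))"
    by (induction rule: rtranclp_induct)
      (use assms(2,3) minor_step_wf_digraph placement_realizable_minor_step in force)+
  then show ?thesis
    using placement_realizable_renaming[OF ren] by simp
qed

subsection \<open>The forbidden minors\<close>

lemma complete_graph_2: "verts (complete_graph 2) = {1, 2}" "arcs (complete_graph 2) = {(1, 2)}"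
  by (auto simp: complete_graph_def)

lemma complete_graph_3:
  "verts (complete_graph 3) = {1, 2, 3}" "arcs (complete_graph 3) = {(1, 2), (1, 3), (2, 3)}"
  by (auto simp: complete_graph_def)

lemma complete_graph_ends: "tail (complete_graph k) = fst" "head (complete_graph k) = snd"
  by (simp_all add: complete_graph_def)

lemma simple_labelling_K2_bullet_iff: "simple_labelling K2_bullet w \<longleftrightarrow> w True \<noteq> w False"
  by (auto simp: simple_labelling_def same_labelled_edge_def K2_bullet_def UNIV_bool)

lemma not_placement_realizable_K3: "\<not> placement_realizable 1 (complete_graph 3) (\<lambda>_. 0)"
proof
  assume real: "placement_realizable 1 (complete_graph 3) (\<lambda>_. 0)"
  define q :: "nat \<Rightarrow> nat \<Rightarrow> real" where "q i k = of_bool (i = k)" for i k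
  have "vec_length 4 (\<lambda>_. 1) \<noteq> 0"
    by (simp add: L2_set_def)
  then obtain l' r where "equivalent_placements (complete_graph 3) (\<lambda>_. 0) 4 (\<lambda>_. 1) q 1 l' r"
    using real unfolding placement_realizable_def by blast
  then have dist: "\<bar>r j 0 - r i 0\<bar> = vec_length 4 (\<lambda>k. q j k - q i k)"
    if "1 \<le> i" "i < j" "j \<le> 3" for i j
    using that by (auto simp: equivalent_placements_def arc_displacement_def complete_graph_def
        vec_length_Suc_0)
  have "\<bar>r 2 0 - r 1 0\<bar> = sqrt 2" "\<bar>r 3 0 - r 1 0\<bar> = sqrt 2" "\<bar>r 3 0 - r 2 0\<bar> = sqrt 2"
    using dist[of 1 2] dist[of 1 3] dist[of 2 3]
    by (simp_all add: q_def L2_set_def eval_nat_numeral)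
  moreover have "sqrt 2 > 0" by simp
  ultimately show False by linarith
qed

lemma equal_squares_imp_half_difference:
  fixes x a b c :: real
  assumes "(x + a * c)\<^sup>2 = (x + b * c)\<^sup>2" "a \<noteq> b" "c \<noteq> 0"
  shows "x + a * c = (a - b) / 2 * c"
proof -
  have "((a - b) * c) * (2 * x + (a + b) * c) = (x + a * c)\<^sup>2 - (x + b * c)\<^sup>2"
    by (simp add: algebra_simps power2_eq_square)
  then have "2 * x + (a + b) * c = 0"
    using assms by simp
  then show ?thesis
    by (simp add: algebra_simps)
qed

text \<open>On a line, equal lengths of the two edges force the second vertex to be the midpoint
  between the two translates; leaving the line at that midpoint gives an unattainable length.\<close>
lemma not_placement_realizable_K2_bullet:
  assumes "simple_labelling K2_bullet w"
  shows "\<not> placement_realizable 1 K2_bullet w"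
proof
  assume real: "placement_realizable 1 K2_bullet w"
  define a b where "a = real_of_int (w True)" and "b = real_of_int (w False)"
  have a_neq_b: "a \<noteq> b"
    using assms by (simp add: simple_labelling_K2_bullet_iff a_def b_def)
  define l :: "nat \<Rightarrow> real" where "l k = of_bool (k = 0)" for k
  define q :: "nat \<Rightarrow> nat \<Rightarrow> real"
    where "q i k = (if i = 1 then 0 else if k = 0 then - (a + b) / 2 else 1)" for i k
  have sum_lessThan_2: "(\<Sum>k<2. h k) = h 0 + h 1" for h :: "nat \<Rightarrow> real"
    by (simp add: numeral_2_eq_2)
  have l: "vec_length 2 l = 1"
    by (simp add: L2_set_def l_def sum_lessThan_2)
  then obtain l' r where eq: "equivalent_placements K2_bullet w 2 l q 1 l' r"
    using real unfolding placement_realizable_def by (metis zero_neq_one)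
  define c x where "c = l' 0" and "x = r 2 0 - r 1 0"
  have c_square: "c\<^sup>2 = 1"
    using eq l by (simp add: equivalent_placements_def vec_length_Suc_0 c_def abs_square_eq_1)
  have "\<bar>x + w e * c\<bar> = vec_length 2 (\<lambda>k. q 2 k - q 1 k + w e * l k)" for e
    using eq by (simp add: equivalent_placements_def arc_displacement_def K2_bullet_def
        vec_length_Suc_0 x_def c_def)
  then have "\<bar>x + w e * c\<bar>\<^sup>2 = (w e - (a + b) / 2)\<^sup>2 + 1" for e
    by (simp add: L2_set_def sum_lessThan_2 q_def l_def field_simps)
  from this[of True] this[of False]
  have eqs: "(x + a * c)\<^sup>2 = ((a - b) / 2)\<^sup>2 + 1" "(x + b * c)\<^sup>2 = ((a - b) / 2)\<^sup>2 + 1"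
    by (simp_all add: field_simps power2_eq_square flip: a_def b_def)
  then have "x + a * c = (a - b) / 2 * c"
    using a_neq_b c_square by (intro equal_squares_imp_half_difference) auto
  then have "(x + a * c)\<^sup>2 = ((a - b) / 2)\<^sup>2 * c\<^sup>2"
    by (simp only: power_mult_distrib)
  with eqs(1) c_square show False
    by simp
qed

definition has_forbidden_minor :: "('v, 'e) zgraph \<Rightarrow> bool" where
  "has_forbidden_minor X \<longleftrightarrow> has_minor_isomorphic X (complete_graph 3, \<lambda>_. 0) \<or>
     (\<exists>w. simple_labelling K2_bullet w \<and> has_minor_isomorphic X (K2_bullet, w))"

lemma placement_realizable_imp_no_forbidden_minor:
  assumes "wf_digraph G" "placement_realizable 1 G z"
  shows "\<not> has_forbidden_minor (G, z)"
  using assms placement_realizable_minor not_placement_realizable_K3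
    not_placement_realizable_K2_bullet
  unfolding has_forbidden_minor_def by metis

subsection \<open>Disjoint unions and 1-sums\<close>

lemma vec_length_first_axis:
  "0 < d \<Longrightarrow> vec_length d (\<lambda>k. if k = 0 then a else 0) = \<bar>a\<bar>"
  by (simp add: L2_set_def if_distrib[where f = "\<lambda>x. x\<^sup>2"] cong: if_cong)

lemma placement_realizable_at_most_one_link:
  assumes "0 < m" and link: "\<And>f. f \<in> arcs G \<Longrightarrow> tail G f \<noteq> head G f \<Longrightarrow> f = e"
  shows "placement_realizable m G z"
  unfolding placement_realizable_def
proof (intro allI impI)
  fix d l and q :: "_ \<Rightarrow> nat \<Rightarrow> real"
  define x where "x = vec_length d (arc_displacement G z l q e)"
  let ?l = "\<lambda>k::nat. if k = 0 then vec_length d l else 0"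
  let ?q = "\<lambda>v k::nat. if k = 0 then (if v = head G e then x - z e * vec_length d l else 0) else 0"
  have "vec_length d (arc_displacement G z l q f) = vec_length m (arc_displacement G z ?l ?q f)"
    if f: "f \<in> arcs G" for f
  proof (cases "tail G f = head G f")
    case True
    then show ?thesis
      using assms(1)
      by (simp add: arc_displacement_def L2_set_cmult vec_length_first_axis)
  next
    case False
    then have "f = e"
      using link f by blast
    then have "arc_displacement G z ?l ?q f = (\<lambda>k. if k = 0 then x else 0)"
      using False by (auto simp: arc_displacement_def)
    then show ?thesis
      using assms(1) \<open>f = e\<close> by (simp add: vec_length_first_axis x_def)
  qed
  then have "equivalent_placements G z d l q m ?l ?q"
    using assms(1) by (simp add: equivalent_placements_def vec_length_first_axis)
  then show "\<exists>l' q'. equivalent_placements G z d l q m l' q'"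
    by blast
qed

text \<open>A reflection makes the lattice vectors of the two summands agree, and then a translation
  makes their placements agree at the only possible common vertex.\<close>
lemma placement_realizable_union:
  assumes union: "is_union G G1 G2" and common: "verts G1 \<inter> verts G2 \<subseteq> {v}"
    and real: "placement_realizable m G1 z" "placement_realizable m G2 z"
  shows "placement_realizable m G z"
  unfolding placement_realizable_def
proof (intro allI impI)
  fix d l and q :: "_ \<Rightarrow> nat \<Rightarrow> real"
  assume l: "vec_length d l \<noteq> 0"
  have G1: "wf_digraph G1" "tail G1 = tail G" "head G1 = head G"
    and G2: "wf_digraph G2" "tail G2 = tail G" "head G2 = head G"
    and arcs: "arcs G = arcs G1 \<union> arcs G2"
    using union by (auto simp: is_union_def subgraph_def compatible_def)
  obtain l' q1 where eq1: "equivalent_placements G1 z d l q m l' q1"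
    using real(1) l unfolding placement_realizable_def by blast
  then have "vec_length m l' = vec_length d l"
    by (simp add: equivalent_placements_def)
  then obtain q2 where eq2: "equivalent_placements G2 z d l q m l' q2"
    using real(2) l ex_equivalent_placement_with_lattice_vector
    unfolding placement_realizable_def by meson
  define q' where "q' u = (if u \<in> verts G1 then q1 u else (\<lambda>k. q2 u k + (q1 v k - q2 v k)))" for u
  have q'_2: "q' u = (\<lambda>k. q2 u k + (q1 v k - q2 v k))" if "u \<in> verts G2" for u
    using that common by (auto simp: q'_def)
  have "arc_displacement G z l' q' e = arc_displacement G1 z l' q1 e" if "e \<in> arcs G1" for e
    using that G1 by (simp add: arc_displacement_def q'_def wf_digraph_def)
  moreover have "arc_displacement G z l' q' e = arc_displacement G2 z l' q2 e"
    if "e \<in> arcs G2" for e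
    using that G2 by (simp add: arc_displacement_def q'_2 wf_digraph_def)
  moreover have "arc_displacement G1 z l q = arc_displacement G z l q"
    "arc_displacement G2 z l q = arc_displacement G z l q"
    using G1 G2 by (simp_all add: fun_eq_iff arc_displacement_def)
  ultimately have "equivalent_placements G z d l q m l' q'"
    using eq1 eq2 by (auto simp: equivalent_placements_def arcs)
  then show "\<exists>l' q'. equivalent_placements G z d l q m l' q'"
    by blast
qed

lemma zgraph_isomorphic_bij_betw:
  assumes "zgraph_isomorphic (G, z) (H, w)"
  shows "\<exists>f. bij_betw f (verts G) (verts H)" "\<exists>g. bij_betw g (arcs G) (arcs H)"
proof -
  obtain X f g where steps: "relabel_step\<^sup>*\<^sup>* (G, z) X" and ren: "zgraph_renaming f g X (H, w)"
    using assms unfolding zgraph_isomorphic_iff_renaming by blast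
  have "verts (fst Y) = verts (fst X) \<and> arcs (fst Y) = arcs (fst X)" if "relabel_step X Y"
    for X Y :: "('a, 'b) zgraph"
    using that by cases (auto simp: invert_edge_eq switch_vertex_eq)
  with steps have "verts (fst X) = verts G \<and> arcs (fst X) = arcs G"
    by (induction rule: rtranclp_induct) auto
  with ren show "\<exists>f. bij_betw f (verts G) (verts H)" "\<exists>g. bij_betw g (arcs G) (arcs H)"
    by (auto simp: zgraph_renaming_def)
qed

lemma in_F_imp_at_most_one_link:
  assumes "in_F G z"
  shows "\<exists>e. \<forall>f\<in>arcs G. tail G f \<noteq> head G f \<longrightarrow> f = e"
proof -
  have wf: "wf_digraph G"
    using assms by (auto simp: in_F_def Z_labelled_graph_def fin_digraph_def)
  consider (K2) "zgraph_isomorphic (G, z) (complete_graph 2, \<lambda>_. 0)"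
    | (vertex) H :: "('a, 'b) pre_digraph" and w v where "verts H = {v}"
      "zgraph_isomorphic (G, z) (H, w)"
    using assms unfolding in_F_def by blast
  then show ?thesis
  proof cases
    case K2
    then have "card (arcs G) = 1"
      using zgraph_isomorphic_bij_betw(2)
      by (fastforce simp: complete_graph_2 dest: bij_betw_same_card)
    then show ?thesis
      by (auto simp: card_1_singleton_iff)
  next
    case vertex
    then have "card (verts G) = 1"
      using zgraph_isomorphic_bij_betw(1)[OF vertex(2)] by (auto dest: bij_betw_same_card)
    then show ?thesis
      using wf by (auto simp: card_1_singleton_iff wf_digraph_def)
  qed
qed

lemma sum_of_F_imp_placement_realizable:
  assumes "sum_of_F G z" "0 < m"
  shows "placement_realizable m G z"
  using assms
proof (induction rule: sum_of_F.induct)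
  case (null G z)
  then have "arcs G = {}"
    by (auto simp: Z_labelled_graph_def fin_digraph_def wf_digraph_def)
  then show ?case
    using null by (intro placement_realizable_at_most_one_link) auto
next
  case (base G z)
  then show ?case
    using in_F_imp_at_most_one_link placement_realizable_at_most_one_link by metis
next
  case (disjoint_union G z G1 G2)
  then show ?case
    unfolding is_disjoint_union_def by (blast intro: placement_realizable_union)
next
  case (one_sum G z G1 G2)
  then show ?case
    unfolding is_one_sum_def by (blast intro: placement_realizable_union)
qed

subsection \<open>Decomposition of acyclic graphs\<close>

definition has_proper_cycle :: "('v, 'e) pre_digraph \<Rightarrow> bool" where
  "has_proper_cycle G \<longleftrightarrow> (\<exists>vs es. undirected_cycle G vs es \<and> 2 \<le> length vs)"

lemma has_proper_cycle_iff_not_loop: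
  "has_proper_cycle G \<longleftrightarrow>
   (\<exists>vs es. undirected_cycle G vs es \<and> \<not> (\<exists>e. es = [e] \<and> tail G e = head G e))"
proof -
  have "2 \<le> length vs \<longleftrightarrow> \<not> (\<exists>e. es = [e] \<and> tail G e = head G e)"
    if cyc: "undirected_cycle G vs es" for vs es
  proof (cases "2 \<le> length vs")
    case True
    then show ?thesis using cyc by (auto simp: undirected_cycle_def)
  next
    case False
    then obtain v e where "vs = [v]" "es = [e]"
      using cyc by (cases vs; cases es) (auto simp: undirected_cycle_def Suc_le_eq)
    then show ?thesis
      using cyc by (auto simp: undirected_cycle_def)
  qed
  then show ?thesis
    unfolding has_proper_cycle_def by blast
qed

lemma has_proper_cycle_subgraph:
  assumes "subgraph H G" "has_proper_cycle H"
  shows "has_proper_cycle G"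
proof -
  have "undirected_cycle G vs es" if "undirected_cycle H vs es" for vs es
    using assms(1) that by (auto simp: undirected_cycle_def subgraph_def compatible_def)
  then show ?thesis
    using assms(2) unfolding has_proper_cycle_def by blast
qed

definition undirected_path :: "('v, 'e) pre_digraph \<Rightarrow> 'v list \<Rightarrow> 'e list \<Rightarrow> bool" where
  "undirected_path G vs es \<longleftrightarrow>
     length vs = Suc (length es) \<and> distinct vs \<and> set vs \<subseteq> verts G \<and> set es \<subseteq> arcs G \<and>
     (\<forall>t<length es. {tail G (es ! t), head G (es ! t)} = {vs ! t, vs ! Suc t})"

lemma undirected_path_take:
  assumes "undirected_path G vs es" "n \<le> length es"
  shows "undirected_path G (take (Suc n) vs) (take n es)"
  using assms set_take_subset[of n es] set_take_subset[of "Suc n" vs]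
  by (auto simp: undirected_path_def)

lemma undirected_path_Cons:
  assumes "undirected_path G (v # vs) es" "w \<in> verts G" "w \<notin> set (v # vs)"
    "e \<in> arcs G" "{tail G e, head G e} = {w, v}"
  shows "undirected_path G (w # v # vs) (e # es)"
proof -
  have "{tail G ((e # es) ! t), head G ((e # es) ! t)} = {(w # v # vs) ! t, (w # v # vs) ! Suc t}"
    if "t < length (e # es)" for t
    using assms that by (cases t) (simp_all add: undirected_path_def)
  then show ?thesis
    using assms by (simp add: undirected_path_def)
qed

lemma undirected_path_distinct_arcs:
  assumes "undirected_path G vs es"
  shows "distinct es"
  unfolding distinct_conv_nth
proof (intro allI impI)
  fix s t
  assume st: "s < length es" "t < length es" "s \<noteq> t"
  then have "{vs ! s, vs ! Suc s} \<noteq> {vs ! t, vs ! Suc t}"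
    using assms by (auto simp: undirected_path_def doubleton_eq_iff nth_eq_iff_index_eq)
  then show "es ! s \<noteq> es ! t"
    using assms st by (metis undirected_path_def)
qed

lemma undirected_path_close:
  assumes path: "undirected_path G vs es"
    and e: "e \<in> arcs G" "e \<notin> set es" "{tail G e, head G e} = {hd vs, last vs}"
  shows "undirected_cycle G vs (es @ [e])"
proof -
  have len: "length vs = Suc (length es)"
    and steps: "\<forall>t<length es. {tail G (es ! t), head G (es ! t)} = {vs ! t, vs ! Suc t}"
    using path by (simp_all add: undirected_path_def)
  have "vs \<noteq> []"
    using len by auto
  then have ends: "hd vs = vs ! 0" "last vs = vs ! length es"
    using len by (simp_all add: hd_conv_nth last_conv_nth)
  have "{tail G ((es @ [e]) ! t), head G ((es @ [e]) ! t)} = {vs ! t, vs ! (Suc t mod length vs)}"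
    if "t < length vs" for t
  proof (cases "t < length es")
    case True
    then have "Suc t mod length vs = Suc t"
      using len by simp
    then show ?thesis
      using True steps by (simp add: nth_append)
  next
    case False
    then have "t = length es"
      using that len by simp
    then show ?thesis
      using e(3) ends len by (simp add: insert_commute)
  qed
  then show ?thesis
    using path e(1,2) undirected_path_distinct_arcs[OF path]
    by (auto simp: undirected_cycle_def undirected_path_def)
qed

lemma undirected_path_arc_at_hd:
  assumes path: "undirected_path G vs es" and e: "e \<in> set es" "hd vs \<in> {tail G e, head G e}"
  shows "e = es ! 0"
proof -
  obtain t where t: "t < length es" "e = es ! t"
    using e(1) by (auto simp: in_set_conv_nth)
  have len: "length vs = Suc (length es)" and "distinct vs"
    using path by (simp_all add: undirected_path_def)
  have "hd vs = vs ! 0"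
    using len by (metis hd_conv_nth list.size(3) nat.distinct(1))
  moreover have "{tail G e, head G e} = {vs ! t, vs ! Suc t}"
    using path t by (simp add: undirected_path_def)
  ultimately have "vs ! t = vs ! 0 \<or> vs ! Suc t = vs ! 0"
    using e(2) by simp argo
  moreover have "0 < length vs" "t < length vs" "Suc t < length vs"
    using t(1) len by linarith+
  ultimately have "t = 0"
    using nth_eq_iff_index_eq[OF \<open>distinct vs\<close>] by blast
  then show ?thesis
    by (simp add: t(2))
qed

lemma undirected_path_chord_imp_has_proper_cycle:
  assumes path: "undirected_path G vs es"
    and e: "e \<in> arcs G" "e \<noteq> es ! 0" "{tail G e, head G e} = {hd vs, w}"
    and w: "w \<in> set vs" "w \<noteq> hd vs"
  shows "has_proper_cycle G"
proof -
  obtain j where j: "j < length vs" "vs ! j = w"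
    using w(1) by (auto simp: in_set_conv_nth)
  moreover have "hd vs = vs ! 0"
    using w(1) by (intro hd_conv_nth) auto
  ultimately have "0 < j"
    using w(2) by (cases j) auto
  have "e \<notin> set es"
    using undirected_path_arc_at_hd[OF path] e(2,3) by blast
  then have "e \<notin> set (take j es)"
    by (meson in_set_takeD)
  moreover have "undirected_path G (take (Suc j) vs) (take j es)"
    using path j(1) by (intro undirected_path_take) (simp_all add: undirected_path_def)
  moreover have "hd (take (Suc j) vs) = hd vs" "last (take (Suc j) vs) = w"
    using j by (simp, simp add: take_Suc_conv_app_nth)
  ultimately have "undirected_cycle G (take (Suc j) vs) (take j es @ [e])"
    using undirected_path_close e(1,3) by metis
  moreover have "2 \<le> length (take (Suc j) vs)"
    using \<open>0 < j\<close> j(1) by simp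
  ultimately show ?thesis
    unfolding has_proper_cycle_def by blast
qed

text \<open>The vertex is an end of a longest path.\<close>
lemma ex_vertex_with_at_most_one_link:
  assumes "fin_digraph G" "verts G \<noteq> {}" "\<not> has_proper_cycle G"
  shows "\<exists>v\<in>verts G. \<exists>e. \<forall>f\<in>arcs G.
    tail G f \<noteq> head G f \<longrightarrow> v \<in> {tail G f, head G f} \<longrightarrow> f = e"
proof -
  interpret fin_digraph G by fact
  obtain u where "u \<in> verts G"
    using assms(2) by blast
  then have "undirected_path G [u] []"
    by (simp add: undirected_path_def)
  moreover have "length vs < Suc (card (verts G))" if "undirected_path G vs es" for vs es
    using that unfolding less_Suc_eq_le
    by (metis card_mono distinct_card finite_verts undirected_path_def)
  ultimately obtain vs es where path: "undirected_path G vs es"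
    and longest: "\<And>vs' es'. undirected_path G vs' es' \<Longrightarrow> length vs' \<le> length vs"
    using ex_has_greatest_nat[of "\<lambda>vs. \<exists>es. undirected_path G vs es" "[u]" length] by blast
  obtain v vs' where vs: "vs = v # vs'"
    using path by (cases vs) (auto simp: undirected_path_def)
  have "f = es ! 0" if f: "f \<in> arcs G" "tail G f \<noteq> head G f" "v \<in> {tail G f, head G f}" for f
  proof (rule ccontr)
    assume first: "f \<noteq> es ! 0"
    define w where "w = (if v = tail G f then head G f else tail G f)"
    have w: "{tail G f, head G f} = {v, w}" "w \<noteq> v" "w \<in> verts G"
      using f by (auto simp: w_def)
    have "w \<notin> set vs"
      using undirected_path_chord_imp_has_proper_cycle[OF path f(1) first] w(1,2) assms(3)
      by (auto simp: vs)
    then have "undirected_path G (w # vs) (f # es)"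
      using undirected_path_Cons[of G v vs' es w f] path w(1,3) f(1)
      by (simp add: vs insert_commute)
    then show False
      using longest[of "w # vs"] by simp
  qed
  moreover have "v \<in> verts G"
    using path by (simp add: undirected_path_def vs)
  ultimately show ?thesis
    by blast
qed

lemma Z_labelled_graph_subgraph:
  assumes "Z_labelled_graph G z" "subgraph H G"
  shows "Z_labelled_graph H z"
proof -
  have H: "arcs H \<subseteq> arcs G" "tail H = tail G" "head H = head G"
    using assms(2) by (auto simp: subgraph_def compatible_def)
  then have "same_labelled_edge H z = same_labelled_edge G z"
    by (simp add: fun_eq_iff same_labelled_edge_def)
  then have "simple_labelling H z"
    using assms(1) H by (auto simp: Z_labelled_graph_def simple_labelling_def)
  then show ?thesis
    using assms fin_digraph.fin_digraph_subgraph by (auto simp: Z_labelled_graph_def)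
qed

lemma in_F_single_vertex:
  assumes "Z_labelled_graph G z" "verts G = {v}"
  shows "in_F G z"
proof -
  have "zgraph_renaming id id (G, z) (G, z)"
    by (simp add: zgraph_renaming_def)
  then have "zgraph_isomorphic (G, z) (G, z)"
    unfolding zgraph_isomorphic_iff_renaming by blast
  then show ?thesis
    using assms unfolding in_F_def by blast
qed

lemma in_F_single_link:
  assumes Z: "Z_labelled_graph G z" and G: "arcs G = {e}" "verts G = {tail G e, head G e}"
    "tail G e \<noteq> head G e"
  shows "in_F G z"
proof -
  let ?s = "(\<lambda>_. 0)(head G e := z e)"
  have "relabel_step\<^sup>*\<^sup>* (G, z) (G, switch_labels ?s G z)"
    using G by (intro relabel_steps_switch_labels[of "{head G e}"]) auto
  moreover have "zgraph_renaming (\<lambda>v. if v = tail G e then 1 else 2) (\<lambda>_. (1, 2))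
      (G, switch_labels ?s G z) (complete_graph 2, \<lambda>_. 0)"
    using G by (auto simp: zgraph_renaming_def bij_betw_def complete_graph_2 complete_graph_ends
        switch_labels_def)
  ultimately show ?thesis
    using Z by (auto simp: in_F_def zgraph_isomorphic_iff_renaming)
qed

lemma sum_of_F_pendant_link:
  assumes Z: "Z_labelled_graph G z" and H: "subgraph H G" "sum_of_F H z"
    and G: "verts G = insert d (verts H)" "arcs G = insert e (arcs H)" "d \<notin> verts H"
    and e: "{tail G e, head G e} = {c, d}" "c \<in> verts H"
  shows "sum_of_F G z"
proof -
  define K where "K = G\<lparr>verts := {c, d}, arcs := {e}\<rparr>"
  have ends: "tail G e = c \<and> head G e = d \<or> tail G e = d \<and> head G e = c"
    using e(1) by (auto simp: doubleton_eq_iff)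
  then have "wf_digraph K"
    by (auto simp: K_def wf_digraph_def)
  then have K: "subgraph K G"
    using Z G(1,2) e(2)
    by (auto simp: K_def subgraph_def compatible_def Z_labelled_graph_def fin_digraph_def)
  have "in_F K z"
    using Z_labelled_graph_subgraph[OF Z K]
    by (rule in_F_single_link[of _ _ e]) (use e(2) G(3) ends in \<open>auto simp: K_def\<close>)
  moreover have "is_one_sum G H K"
    unfolding is_one_sum_def is_union_def
    by (intro conjI exI[of _ c] H(1) K) (use G e(2) in \<open>auto simp: K_def\<close>)
  ultimately show ?thesis
    using sum_of_F.one_sum[OF Z] sum_of_F.base H(2) by blast
qed

lemma sum_of_F_bridge:
  assumes Z: "Z_labelled_graph G z" and C: "C \<subseteq> verts G"
    and e: "e \<in> arcs G" "{tail G e, head G e} = {c, d}" "c \<in> C" "d \<notin> C"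
    and bridge: "\<And>f. f \<in> arcs G \<Longrightarrow> f \<noteq> e \<Longrightarrow> tail G f \<in> C \<longleftrightarrow> head G f \<in> C"
    and sums: "sum_of_F (G \<restriction> C) z" "sum_of_F (G \<restriction> (verts G - C)) z"
  shows "sum_of_F G z"
proof -
  interpret fin_digraph G
    using Z by (simp add: Z_labelled_graph_def)
  define H where "H = G\<lparr>verts := insert d C, arcs := insert e (arcs (G \<restriction> C))\<rparr>"
  have ends: "tail G e = c \<and> head G e = d \<or> tail G e = d \<and> head G e = c"
    using e(2) by (auto simp: doubleton_eq_iff)
  then have d: "d \<in> verts G"
    using e(1) wellformed by auto
  have wf: "wf_digraph H"
    using ends e(3) by (auto simp: H_def wf_digraph_def)
  then have H: "subgraph H G"
    using wf_digraph_axioms e(1) d C by (auto simp: H_def subgraph_def compatible_def)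
  have "subgraph (G \<restriction> C) H"
    using wf wellformed_induce_subgraph by (auto simp: H_def subgraph_def compatible_def)
  then have "sum_of_F H z"
    using Z_labelled_graph_subgraph[OF Z H] sums(1) e(2-4)
    by (intro sum_of_F_pendant_link[of H z "G \<restriction> C" d e c]) (simp_all add: H_def)
  moreover have "is_one_sum G H (G \<restriction> (verts G - C))"
    unfolding is_one_sum_def is_union_def
  proof (intro conjI exI[of _ d])
    show "subgraph (G \<restriction> (verts G - C)) G"
      by (rule subgraph_induce_subgraphI) blast
    show "arcs H \<union> arcs (G \<restriction> (verts G - C)) = arcs G"
      using bridge e(1) by (auto simp: H_def)
  qed (use H C d e(4) in \<open>auto simp: H_def\<close>)
  ultimately show ?thesis
    using sum_of_F.one_sum[OF Z] sums(2) by blast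
qed

lemma sum_of_F_separation:
  assumes Z: "Z_labelled_graph G z" and C: "C \<subseteq> verts G"
    and separated: "\<And>f. f \<in> arcs G \<Longrightarrow> tail G f \<in> C \<longleftrightarrow> head G f \<in> C"
    and sums: "sum_of_F (G \<restriction> C) z" "sum_of_F (G \<restriction> (verts G - C)) z"
  shows "sum_of_F G z"
proof -
  interpret fin_digraph G
    using Z by (simp add: Z_labelled_graph_def)
  have "subgraph (G \<restriction> C) G" "subgraph (G \<restriction> (verts G - C)) G"
    using C by (auto intro: subgraph_induce_subgraphI)
  then have "is_disjoint_union G (G \<restriction> C) (G \<restriction> (verts G - C))"
    using C separated by (auto simp: is_disjoint_union_def is_union_def)
  then show ?thesis
    using sum_of_F.disjoint_union[OF Z] sums by blast
qed

lemma sum_of_F_pendant_vertex: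
  assumes Z: "Z_labelled_graph G z" and v: "v \<in> verts G"
    and link: "\<And>f. f \<in> arcs G \<Longrightarrow> tail G f \<noteq> head G f \<Longrightarrow>
      v \<in> {tail G f, head G f} \<Longrightarrow> f = e"
    and rest: "sum_of_F (G \<restriction> (verts G - {v})) z"
  shows "sum_of_F G z"
proof -
  interpret fin_digraph G
    using Z by (simp add: Z_labelled_graph_def)
  have "subgraph (G \<restriction> {v}) G"
    using v by (auto intro: subgraph_induce_subgraphI)
  from Z_labelled_graph_subgraph[OF Z this] have single: "sum_of_F (G \<restriction> {v}) z"
    by (intro sum_of_F.base in_F_single_vertex) auto
  show ?thesis
  proof (cases "\<exists>f\<in>arcs G. tail G f \<noteq> head G f \<and> v \<in> {tail G f, head G f}")
    case True
    then have e: "e \<in> arcs G" "tail G e \<noteq> head G e" "v \<in> {tail G e, head G e}"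
      using link by blast+
    define d where "d = (if v = tail G e then head G e else tail G e)"
    have d: "{tail G e, head G e} = {v, d}" "d \<noteq> v"
      using e(2,3) by (auto simp: d_def)
    show ?thesis
    proof (rule sum_of_F_bridge[OF Z _ e(1) d(1), of "{v}"])
      show "tail G f \<in> {v} \<longleftrightarrow> head G f \<in> {v}" if "f \<in> arcs G" "f \<noteq> e" for f
        using link[OF that(1)] that(2) by (cases "tail G f = head G f") auto
    qed (use v d(2) single rest in auto)
  next
    case False
    show ?thesis
    proof (rule sum_of_F_separation[OF Z, of "{v}"])
      show "tail G f \<in> {v} \<longleftrightarrow> head G f \<in> {v}" if "f \<in> arcs G" for f
        using False that by auto
    qed (use v single rest in auto)
  qed
qed

lemma acyclic_imp_sum_of_F:
  assumes "Z_labelled_graph G z" "\<not> has_proper_cycle G"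
  shows "sum_of_F G z"
  using assms
proof (induction "card (verts G)" arbitrary: G rule: less_induct)
  case (less G)
  note Z = less.prems(1)
  interpret fin_digraph G
    using Z by (simp add: Z_labelled_graph_def)
  show ?case
  proof (cases "verts G = {}")
    case True
    then show ?thesis
      using Z by (intro sum_of_F.null)
  next
    case False
    then obtain v e where v: "v \<in> verts G"
      and link: "\<And>f. f \<in> arcs G \<Longrightarrow> tail G f \<noteq> head G f \<Longrightarrow>
      v \<in> {tail G f, head G f} \<Longrightarrow> f = e"
      using ex_vertex_with_at_most_one_link[OF fin_digraph_axioms] less.prems(2) by blast
    have sub: "subgraph (G \<restriction> (verts G - {v})) G"
      by (rule subgraph_induce_subgraphI) blast
    have "sum_of_F (G \<restriction> (verts G - {v})) z"
    proof (rule less.hyps)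
      show "card (verts (G \<restriction> (verts G - {v}))) < card (verts G)"
        using v by (intro psubset_card_mono) auto
    qed (use less.prems sub Z_labelled_graph_subgraph has_proper_cycle_subgraph in blast)+
    then show ?thesis
      using Z v link by (rule sum_of_F_pendant_vertex[rotated 3])
  qed
qed

subsection \<open>Cycles contain forbidden minors\<close>

definition spanning_cycle :: "('v, 'e) pre_digraph \<Rightarrow> 'e list \<Rightarrow> bool" where
  "spanning_cycle G es \<longleftrightarrow>
     distinct (map (tail G) es) \<and> map (head G) es = rotate1 (map (tail G) es) \<and>
     arcs G = set es \<and> verts G = tail G ` set es"

lemma spanning_cycle_head_nth:
  assumes "spanning_cycle G es" "t < length es"
  shows "head G (es ! t) = tail G (es ! (Suc t mod length es))"
proof -
  have "head G (es ! t) = rotate1 (map (tail G) es) ! t"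
    using assms by (metis nth_map spanning_cycle_def)
  also have "\<dots> = tail G (es ! (Suc t mod length es))"
  proof -
    have "Suc t mod length es < length es"
      by (rule mod_less_divisor) (use assms(2) in linarith)
    then show ?thesis
      using assms(2) by (simp add: nth_rotate1)
  qed
  finally show ?thesis .
qed

lemma spanning_cycle_tail_nth_inject:
  assumes "spanning_cycle G es" "s < length es" "t < length es"
  shows "tail G (es ! s) = tail G (es ! t) \<longleftrightarrow> s = t"
  using assms by (metis length_map nth_eq_iff_index_eq nth_map spanning_cycle_def)

lemma spanning_cycle_opposite_arcs_imp_length_2:
  assumes cyc: "spanning_cycle G es" and len: "2 \<le> length es"
    and st: "s < length es" "t < length es"
    and opp: "tail G (es ! s) = head G (es ! t)" "head G (es ! s) = tail G (es ! t)"
  shows "length es = 2"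
proof -
  let ?n = "length es"
  note inj = spanning_cycle_tail_nth_inject[OF cyc]
  have mod: "Suc i mod ?n < ?n" for i
    by (rule mod_less_divisor) (use len in linarith)
  have s_eq: "s = Suc t mod ?n"
    using opp(1) spanning_cycle_head_nth[OF cyc st(2)] inj[OF st(1) mod] by simp
  have t_eq: "t = Suc s mod ?n"
    using opp(2) spanning_cycle_head_nth[OF cyc st(1)] inj[OF mod st(2)] by metis
  have "(t + 2) mod ?n = Suc (Suc t mod ?n) mod ?n"
    by (simp add: mod_Suc_eq)
  also have "\<dots> = t mod ?n"
    using s_eq t_eq st(2) by (metis mod_less)
  finally have "(t + 2) mod ?n = t mod ?n" .
  then have "?n dvd 2"
    by (subst (asm) mod_eq_dvd_iff_nat) simp_all
  then show ?thesis
    using len by (auto dest: dvd_imp_le)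
qed

lemma spanning_cycle_no_loops:
  assumes cyc: "spanning_cycle G es" and len: "2 \<le> length es" and e: "e \<in> set es"
  shows "tail G e \<noteq> head G e"
proof
  obtain t where t: "t < length es" "e = es ! t"
    using e by (auto simp: in_set_conv_nth)
  assume "tail G e = head G e"
  then have "tail G (es ! t) = tail G (es ! (Suc t mod length es))"
    using spanning_cycle_head_nth[OF cyc t(1)] t(2) by simp
  moreover have "Suc t mod length es < length es"
    by (rule mod_less_divisor) (use len in linarith)
  ultimately have "t = Suc t mod length es"
    using spanning_cycle_tail_nth_inject[OF cyc t(1)] by blast
  then show False
    using t(1) len by (cases "Suc t = length es") auto
qed

lemma spanning_cycle_simple_labelling_iff:
  assumes cyc: "spanning_cycle G es" and len: "2 \<le> length es"
  shows "simple_labelling G z \<longleftrightarrow> length es \<noteq> 2 \<or> sum_list (map z es) \<noteq> 0"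
proof
  assume simple: "simple_labelling G z"
  have "sum_list (map z es) \<noteq> 0" if two: "length es = 2"
  proof -
    obtain e f where es: "es = [e, f]"
      using two by (auto simp: numeral_2_eq_2 length_Suc_conv)
    with cyc have "\<not> same_labelled_edge G z e f"
      using simple by (auto simp: simple_labelling_def spanning_cycle_def)
    with cyc show ?thesis
      by (auto simp: es same_labelled_edge_def spanning_cycle_def)
  qed
  then show "length es \<noteq> 2 \<or> sum_list (map z es) \<noteq> 0"
    by blast
next
  assume sum: "length es \<noteq> 2 \<or> sum_list (map z es) \<noteq> 0"
  have arcs: "arcs G = set es" and inj: "inj_on (tail G) (set es)"
    using cyc by (auto simp: spanning_cycle_def distinct_map)
  have "\<not> same_labelled_edge G z e f" if ef: "e \<in> set es" "f \<in> set es" "e \<noteq> f" for e f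
  proof
    assume "same_labelled_edge G z e f"
    then have opp: "tail G e = head G f" "head G e = tail G f" "z e = - z f"
      using inj ef by (auto simp: same_labelled_edge_def inj_on_def)
    then have two: "length es = 2"
      using spanning_cycle_opposite_arcs_imp_length_2[OF cyc len] ef by (metis in_set_conv_nth)
    then obtain e' f' where "es = [e', f']"
      by (auto simp: numeral_2_eq_2 length_Suc_conv)
    then show False
      using ef opp(3) sum two by auto
  qed
  then show "simple_labelling G z"
    using spanning_cycle_no_loops[OF cyc len] by (auto simp: simple_labelling_def arcs)
qed

lemma sum_list_switch_labels:
  assumes "spanning_cycle G es"
  shows "sum_list (map (switch_labels s G z) es) = sum_list (map z es)"
proof -
  have rotate: "sum_list (map s (rotate1 xs)) = sum_list (map s xs)" for xs
    by (cases xs) simp_all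
  have "sum_list (map (\<lambda>e. s (head G e)) es) = sum_list (map s (map (head G) es))"
    by (simp add: comp_def)
  also have "\<dots> = sum_list (map s (map (tail G) es))"
    using assms by (simp only: spanning_cycle_def rotate)
  finally have "sum_list (map (\<lambda>e. s (head G e)) es) = sum_list (map (\<lambda>e. s (tail G e)) es)"
    by (simp add: comp_def)
  then show ?thesis
    by (simp add: switch_labels_def sum_list_addf sum_list_subtractf)
qed

lemma spanning_cycle_identify_ends:
  assumes cyc: "spanning_cycle G (e # f # es)"
  shows "spanning_cycle ((identify_ends G e)\<lparr>arcs := set (f # es)\<rparr>) (f # es)"
proof -
  let ?H = "(identify_ends G e)\<lparr>arcs := set (f # es)\<rparr>"
  define a b vs where abv_def: "a = tail G e" "b = tail G f" "vs = map (tail G) es"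
  have heads: "head G e = b" "head G f # map (head G) es = vs @ [a]"
    using cyc by (auto simp: spanning_cycle_def abv_def)
  have distinct: "a \<noteq> b" "a \<notin> set vs" "b \<notin> set vs" "distinct vs"
    using cyc by (auto simp: spanning_cycle_def abv_def)
  define c where "c v = (if v = b then a else v)" for v
  have H: "verts ?H = c ` verts G" "tail ?H = c \<circ> tail G" "head ?H = c \<circ> head G"
    by (simp_all add: identify_ends_def Let_def c_def[abs_def] heads(1) abv_def(1) cong: if_cong)
  have c_simps: "c a = a" "c b = a" "map c vs = vs"
    using distinct by (auto simp: c_def intro: map_idI)
  have tails_H: "map (tail ?H) (f # es) = a # vs"
    unfolding H using c_simps by (simp add: abv_def)
  have "map (head ?H) (f # es) = map c (head G f # map (head G) es)"
    unfolding H by simp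
  also have "\<dots> = vs @ [a]"
    using c_simps unfolding heads by simp
  finally have heads_H: "map (head ?H) (f # es) = vs @ [a]" .
  have "verts ?H = c ` insert a (insert b (set vs))"
    using cyc unfolding H by (simp add: spanning_cycle_def abv_def)
  also have "\<dots> = set (map (tail ?H) (f # es))"
    unfolding tails_H using c_simps by simp (metis list.set_map)
  finally have "verts ?H = tail ?H ` set (f # es)"
    by simp
  with distinct show ?thesis
    unfolding spanning_cycle_def tails_H heads_H by simp
qed

lemma spanning_cycle_contract:
  assumes cyc: "spanning_cycle G (e # f # es)" and "es \<noteq> []"
    and sum: "length es \<noteq> 1 \<or> sum_list (map z (e # f # es)) \<noteq> 0"
  shows "\<exists>H w. minor_step\<^sup>*\<^sup>* (G, z) (H, w) \<and> spanning_cycle H (f # es) \<and> simple_labelling H w"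
proof -
  define H where "H = (identify_ends G e)\<lparr>arcs := set (f # es)\<rparr>"
  define s where "s = (\<lambda>_. 0)(head G e := z e)"
  define w where "w = switch_labels s G z"
  have e: "e \<in> arcs G" "head G e \<in> verts G" "tail G e \<noteq> head G e"
    using cyc by (auto simp: spanning_cycle_def)
  then have "relabel_step\<^sup>*\<^sup>* (G, z) (G, w)"
    unfolding w_def by (intro relabel_steps_switch_labels[of "{head G e}"]) (simp_all add: s_def)
  then have switch: "minor_step\<^sup>*\<^sup>* (G, z) (G, w)"
    by (rule relabel_steps_imp_minor_steps)
  have "w e = 0"
    using e(3) by (simp add: w_def s_def switch_labels_def)
  then have "sum_list (map w (f # es)) = sum_list (map z (e # f # es))"
    using sum_list_switch_labels[OF cyc, of s z] by (simp add: w_def)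
  moreover have cyc_H: "spanning_cycle H (f # es)"
    unfolding H_def by (rule spanning_cycle_identify_ends[OF cyc])
  ultimately have simple: "simple_labelling H w"
    using spanning_cycle_simple_labelling_iff[OF cyc_H, of w] \<open>es \<noteq> []\<close> sum by (cases es) auto
  have "arcs (identify_ends G e) = set (f # es)"
    using cyc by (auto simp: identify_ends_def Let_def spanning_cycle_def)
  then have "contraction_arcs G w e (set (f # es))"
    using simple by (auto simp: contraction_arcs_def Let_def H_def)
  then have "minor_step (G, w) (H, w)"
    unfolding H_def using e(1,3) \<open>w e = 0\<close> by (intro minor_step.contract)
  with switch cyc_H simple show ?thesis
    by (meson rtranclp.rtrancl_into_rtrancl)
qed

lemma has_forbidden_minor_trans:
  "minor_step\<^sup>*\<^sup>* X Y \<Longrightarrow> has_forbidden_minor Y \<Longrightarrow> has_forbidden_minor X"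
  unfolding has_forbidden_minor_def has_minor_isomorphic_def by (meson rtranclp_trans)

lemma spanning_2_cycle_has_forbidden_minor:
  assumes cyc: "spanning_cycle G [e, f]" and lab: "z e + z f \<noteq> 0"
  shows "has_forbidden_minor (G, z)"
proof -
  have G: "arcs G = {e, f}" "verts G = {tail G e, tail G f}" "head G e = tail G f"
    "head G f = tail G e" "tail G e \<noteq> tail G f"
    using cyc by (auto simp: spanning_cycle_def)
  then have "e \<noteq> f"
    by blast
  define w where "w b = (if b then z e else - z f)" for b
  have "minor_step\<^sup>*\<^sup>* (G, z) (reverse_arcs {f} G, negate_labels {f} z)"
    using G(1) by (intro relabel_steps_imp_minor_steps relabel_steps_reverse_arcs) simp_all
  moreover have "zgraph_renaming (\<lambda>v. if v = tail G e then 1 else 2) (\<lambda>x. x = e)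
      (reverse_arcs {f} G, negate_labels {f} z) (K2_bullet, w)"
    using G \<open>e \<noteq> f\<close>
    by (auto simp: zgraph_renaming_def bij_betw_def K2_bullet_def w_def negate_labels_def UNIV_bool)
  moreover have "simple_labelling K2_bullet w"
    using lab by (simp add: simple_labelling_K2_bullet_iff w_def eq_neg_iff_add_eq_0)
  ultimately show ?thesis
    unfolding has_forbidden_minor_def has_minor_isomorphic_iff_renaming by blast
qed

lemma balanced_spanning_3_cycle_has_forbidden_minor:
  assumes cyc: "spanning_cycle G [e, f, g]" and lab: "z e + z f + z g = 0"
  shows "has_forbidden_minor (G, z)"
proof -
  define a b c where abc_def: "a = tail G e" "b = tail G f" "c = tail G g"
  have G: "arcs G = {e, f, g}" "verts G = {a, b, c}" "tail G e = a" "tail G f = b" "tail G g = c"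
    "head G e = b" "head G f = c" "head G g = a" "a \<noteq> b" "a \<noteq> c" "b \<noteq> c"
    using cyc by (auto simp: spanning_cycle_def abc_def)
  then have ne: "e \<noteq> f" "e \<noteq> g" "f \<noteq> g"
    by auto
  define s where "s = (\<lambda>_. 0)(b := z e, c := z e + z f)"
  let ?H = "reverse_arcs {g} G" and ?w = "negate_labels {g} (switch_labels s G z)"
  have "relabel_step\<^sup>*\<^sup>* (G, z) (G, switch_labels s G z)"
    using G(2) by (intro relabel_steps_switch_labels[of "{b, c}"]) (auto simp: s_def)
  also have "relabel_step\<^sup>*\<^sup>* (G, switch_labels s G z) (?H, ?w)"
    using G(1) by (intro relabel_steps_reverse_arcs) simp_all
  finally have "minor_step\<^sup>*\<^sup>* (G, z) (?H, ?w)"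
    by (rule relabel_steps_imp_minor_steps)
  moreover have "?w x = 0" if "x \<in> arcs G" for x
    using that lab G by (auto simp: negate_labels_def switch_labels_def s_def)
  then have "zgraph_renaming (\<lambda>v. if v = a then 1 else if v = b then 2 else 3)
      (\<lambda>x. if x = e then (1, 2) else if x = f then (2, 3) else (1, 3)) (?H, ?w)
      (complete_graph 3, \<lambda>_. 0)"
    using G ne
    by (auto simp: zgraph_renaming_def bij_betw_def complete_graph_3 complete_graph_ends)
  ultimately show ?thesis
    unfolding has_forbidden_minor_def has_minor_isomorphic_iff_renaming by blast
qed

lemma spanning_cycle_has_forbidden_minor:
  assumes "spanning_cycle G es" "2 \<le> length es" "simple_labelling G z"
  shows "has_forbidden_minor (G, z)"
  using assms
proof (induction "length es" arbitrary: G z es rule: less_induct)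
  case less
  note cyc = less.prems(1)
  obtain e f es' where es: "es = e # f # es'"
    using less.prems(2) by (cases es; cases "tl es") auto
  consider (two) "es' = []"
    | (balanced_triangle) g where "es' = [g]" "z e + z f + z g = 0"
    | (contractible) "es' \<noteq> []" "length es' \<noteq> 1 \<or> sum_list (map z es) \<noteq> 0"
    by (cases es'; cases "tl es'") (auto simp: es add.assoc)
  then show ?case
  proof cases
    case two
    then have "z e + z f \<noteq> 0"
      using spanning_cycle_simple_labelling_iff[OF cyc less.prems(2)] less.prems(3)
      by (simp add: es)
    then show ?thesis
      using cyc two by (simp add: es spanning_2_cycle_has_forbidden_minor)
  next
    case balanced_triangle
    then show ?thesis
      using cyc by (simp add: es balanced_spanning_3_cycle_has_forbidden_minor)
  next
    case contractible
    then obtain H w where H: "minor_step\<^sup>*\<^sup>* (G, z) (H, w)" "spanning_cycle H (f # es')"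
        "simple_labelling H w"
      using spanning_cycle_contract[OF cyc[unfolded es], of z] unfolding es by blast
    then have "has_forbidden_minor (H, w)"
      using contractible(1) by (intro less.hyps[of "f # es'"]) (simp_all add: es Suc_le_eq)
    with H(1) show ?thesis
      by (rule has_forbidden_minor_trans)
  qed
qed

lemma undirected_cycle_orientation:
  assumes cyc: "undirected_cycle G vs es" and G: "arcs G = set es" "verts G = set vs"
  shows "\<exists>B \<subseteq> arcs G. spanning_cycle (reverse_arcs B G) es"
proof -
  define B where "B = {es ! t | t. t < length vs \<and> tail G (es ! t) \<noteq> vs ! t}"
  have len: "length es = length vs" and dist: "distinct vs" "distinct es"
    and ends: "\<And>t. t < length vs \<Longrightarrow>
      {tail G (es ! t), head G (es ! t)} = {vs ! t, vs ! (Suc t mod length vs)}"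
    using cyc by (auto simp: undirected_cycle_def)
  have "es ! t \<in> B \<longleftrightarrow> tail G (es ! t) \<noteq> vs ! t" if "t < length vs" for t
    using that len dist(2) by (auto simp: B_def nth_eq_iff_index_eq)
  then have arc: "tail (reverse_arcs B G) (es ! t) = vs ! t"
      "head (reverse_arcs B G) (es ! t) = vs ! (Suc t mod length vs)" if "t < length vs" for t
    using that ends[OF that] by (auto simp: doubleton_eq_iff)
  have tails: "map (tail (reverse_arcs B G)) es = vs"
    using len arc(1) by (intro nth_equalityI) simp_all
  moreover have "map (head (reverse_arcs B G)) es = rotate1 vs"
    using len arc(2) by (intro nth_equalityI) (simp_all add: nth_rotate1)
  moreover have "verts G = tail (reverse_arcs B G) ` set es"
    using G(2) tails by (metis list.set_map)
  ultimately have "spanning_cycle (reverse_arcs B G) es"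
    using dist(1) G(1) by (simp add: spanning_cycle_def)
  moreover have "B \<subseteq> arcs G"
    unfolding B_def G(1) using len by (auto intro!: nth_mem)
  ultimately show ?thesis
    by blast
qed

lemma undirected_cycle_ends:
  assumes "undirected_cycle G vs es" "e \<in> set es"
  shows "tail G e \<in> set vs" "head G e \<in> set vs"
proof -
  obtain t where t: "t < length vs" "e = es ! t"
    using assms by (auto simp: undirected_cycle_def in_set_conv_nth)
  moreover have "Suc t mod length vs < length vs"
    by (rule mod_less_divisor) (use t(1) in linarith)
  ultimately have "{tail G e, head G e} \<subseteq> set vs"
    using assms(1) by (simp add: undirected_cycle_def)
  then show "tail G e \<in> set vs" "head G e \<in> set vs"
    by simp_all
qed

lemma has_proper_cycle_imp_has_forbidden_minor:
  assumes Z: "Z_labelled_graph G z" and "has_proper_cycle G"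
  shows "has_forbidden_minor (G, z)"
proof -
  interpret fin_digraph G
    using Z by (simp add: Z_labelled_graph_def)
  obtain vs es where cyc: "undirected_cycle G vs es" and len: "2 \<le> length vs"
    using assms(2) unfolding has_proper_cycle_def by blast
  define H where "H = G\<lparr>verts := set vs, arcs := set es\<rparr>"
  have sub: "subgraph H G"
    using cyc undirected_cycle_ends[OF cyc] wf_digraph_axioms
    by (auto simp: H_def subgraph_def compatible_def undirected_cycle_def wf_digraph_def)
  have "undirected_cycle H vs es"
    using cyc by (simp add: H_def undirected_cycle_def)
  then obtain B where B: "B \<subseteq> arcs H" "spanning_cycle (reverse_arcs B H) es"
    using undirected_cycle_orientation[of H vs es] by (auto simp: H_def)
  have "simple_labelling H z"
    using Z_labelled_graph_subgraph[OF Z sub] by (simp add: Z_labelled_graph_def)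
  then have "has_forbidden_minor (reverse_arcs B H, negate_labels B z)"
    using B(2) len cyc
    by (intro spanning_cycle_has_forbidden_minor simple_labelling_reverse_arcs)
      (auto simp: undirected_cycle_def)
  moreover have "minor_step\<^sup>*\<^sup>* (G, z) (H, z)"
    using fin_digraph_axioms sub by (rule minor_steps_subgraph)
  moreover have "minor_step\<^sup>*\<^sup>* (H, z) (reverse_arcs B H, negate_labels B z)"
    using B(1) by (intro relabel_steps_imp_minor_steps relabel_steps_reverse_arcs)
      (auto simp: H_def intro: finite_subset)
  ultimately show ?thesis
    using has_forbidden_minor_trans by blast
qed

theorem theorem7p3:
  fixes G :: "('v, 'e) pre_digraph" and z :: "'e \<Rightarrow> int"
  assumes "Z_labelled_graph G z"
  shows "(rd G z \<le> 1 \<longleftrightarrow>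
            \<not> has_minor_isomorphic (G, z) (complete_graph 3, \<lambda>_. 0) \<and>
            (\<forall>w. simple_labelling K2_bullet w \<longrightarrow> \<not> has_minor_isomorphic (G, z) (K2_bullet, w))) \<and>
         (rd G z \<le> 1 \<longleftrightarrow> sum_of_F G z) \<and>
         (rd G z \<le> 1 \<longleftrightarrow>
            \<not> (\<exists>vs es. undirected_cycle G vs es \<and> \<not> (\<exists>e. es = [e] \<and> tail G e = head G e)))"
proof -
  have wf: "wf_digraph G"
    using assms by (simp add: Z_labelled_graph_def fin_digraph_def)
  then have "rd G z \<le> 1 \<longleftrightarrow> placement_realizable 1 G z"
    unfolding one_enat_def by (rule rd_le_iff_placement_realizable)
  moreover have "placement_realizable 1 G z \<Longrightarrow> \<not> has_forbidden_minor (G, z)"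
    by (rule placement_realizable_imp_no_forbidden_minor[OF wf])
  moreover have "\<not> has_forbidden_minor (G, z) \<Longrightarrow> \<not> has_proper_cycle G"
    using has_proper_cycle_imp_has_forbidden_minor[OF assms] by blast
  moreover have "\<not> has_proper_cycle G \<Longrightarrow> sum_of_F G z"
    by (rule acyclic_imp_sum_of_F[OF assms])
  moreover have "sum_of_F G z \<Longrightarrow> placement_realizable 1 G z"
    by (simp add: sum_of_F_imp_placement_realizable)
  ultimately have "(rd G z \<le> 1 \<longleftrightarrow> \<not> has_forbidden_minor (G, z)) \<and>
      (rd G z \<le> 1 \<longleftrightarrow> sum_of_F G z) \<and> (rd G z \<le> 1 \<longleftrightarrow> \<not> has_proper_cycle G)"
    by blast
  then show ?thesis
    unfolding has_forbidden_minor_def has_proper_cycle_iff_not_loop by blast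
qed

end
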